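(* For every integer $d\geq 3$ there exist a finite set of matrices $\mathcal{M}\subseteq\mathbb{R}^{d\times d}$ with joint spectral radius $\rho(\mathcal{M})=1$ and a constant $C>1$ such that for all $T\in\mathbf{GL}_d(\mathbb{R})$ and for all $J\subseteq\{1,\dots,d\}$ with $|J|\in\{2,\dots,d-1\}$ we have $$\rho\big((T^{-1}\mathcal{M}T)_{J,J}\big)\geq C.$$
   Context: For a nonempty bounded set $\mathcal{M}$ of real square matrices of a fixed size and an integer $t\ge 1$ let $\mathcal{S}_t := \{A(t-1)\cdots A(0) : A(s)\in\mathcal{M},\ s=0,\dots,t-1\}$ be the set of products of length $t$. The joint spectral radius is $\rho(\mathcal{M}) := \lim_{t\to\infty}\sup\{\|S\|_2 : S\in\mathcal{S}_t\}^{1/t}$, where $\|\cdot\|_2$ is the spectral norm. For $T\in\mathbf{GL}_d(\mathbb{R})$, $T^{-1}\mathcal{M}T := \{T^{-1}AT : A\in\mathcal{M}\}$. For a nonempty index set $J\subseteq\{1,\dots,d\}$ and a $d\times d$ matrix $A$, $A_{J,J}$ is the principal submatrix of $A$ obtained by deleting all rows and columns whose index is not in $J$, and for a set of $d\times d$ matrices $\mathcal{M}$, $\mathcal{M}_{J,J}:=\{A_{J,J} : A\in\mathcal{M}\}$. *)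

theory Defs
  imports Complex_Main "Jordan_Normal_Form.DL_Submatrix"
begin

definition vec_norm2 :: "real vec \<Rightarrow> real" where
  "vec_norm2 x = sqrt (x \<bullet> x)"

(* The unit ball rather than the unit sphere, so that the set is nonempty in dimension 0 too. *)
definition spectral_norm :: "real mat \<Rightarrow> real" where
  "spectral_norm A =
     Sup {vec_norm2 (A *\<^sub>v x) | x. x \<in> carrier_vec (dim_col A) \<and> vec_norm2 x \<le> 1}"

text \<open>\<open>left_prod n A t\<close> is \<open>A (t - 1) * \<dots> * A 0\<close> for \<open>n \<times> n\<close> matrices \<open>A s\<close>.\<close>

fun left_prod :: "nat \<Rightarrow> (nat \<Rightarrow> real mat) \<Rightarrow> nat \<Rightarrow> real mat" where
  "left_prod n A 0 = 1\<^sub>m n"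
| "left_prod n A (Suc t) = A t * left_prod n A t"

definition products :: "nat \<Rightarrow> real mat set \<Rightarrow> nat \<Rightarrow> real mat set" where
  "products n M t = {left_prod n A t | A. \<forall>s<t. A s \<in> M}"

text \<open>The joint spectral radius is meaningful for a nonempty set \<open>M \<subseteq> carrier_mat n n\<close> with
  bounded norms; the limit exists by submultiplicativity of the norm.\<close>

definition jsr :: "nat \<Rightarrow> real mat set \<Rightarrow> real" where
  "jsr n M = lim (\<lambda>t. root t (Sup (spectral_norm ` products n M t)))"

definition GL :: "nat \<Rightarrow> real mat set" where
  "GL d = Units (ring_mat TYPE(real) d ())"

definition conj_set :: "nat \<Rightarrow> real mat \<Rightarrow> real mat set \<Rightarrow> real mat set" where
  "conj_set d T M = (\<lambda>A. inv\<^bsub>ring_mat TYPE(real) d ()\<^esub> T * A * T) ` M"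

definition principal_submatrices :: "nat set \<Rightarrow> real mat set \<Rightarrow> real mat set" where
  "principal_submatrices J M = (\<lambda>A. submatrix A J J) ` M"

end

theory Submission
  imports "HOL-Analysis.Convex" "HOL-Analysis.Function_Topology" "HOL-Analysis.Elementary_Normed_Spaces"
    Defs
begin

text \<open>The idea is to translate the statement into one about norms without contractive
  projections. Take a set of rank-one matrices \<open>x f\<^sup>T\<close>, with \<open>x\<close>
  from a symmetric convex body and \<open>f\<close> from its polar. Products of such matrices are
  governed by the scalars \<open>f\<^sup>T x\<close>, so the joint spectral radius is the largest
  \<open>|f\<^sup>T x|\<close> (\<open>jsr_outer\<close>), which is \<open>1\<close> as soon as
  one contact pair is present. Passing to \<open>T\<^sup>-\<^sup>1 M T\<close> and to the
  principal submatrices for \<open>J\<close> replaces \<open>f\<^sup>T x\<close> by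
  \<open>f\<^sup>T P x\<close>, where \<open>P\<close> is a projection of rank
  \<open>|J|\<close>, and every projection arises in this way. If \<open>x\<close> and
  \<open>f\<close> ran over the whole body and its polar, the joint spectral radius of the
  compression would be the operator norm of \<open>P\<close>. What is needed is a norm for which
  no projection of rank \<open>2, \<dots>, d - 1\<close> has norm \<open>1\<close>; compactness
  then provides finitely many pairs \<open>(x, f)\<close> and a uniform constant
  (\<open>finite_certificate\<close>). Ranks \<open>1\<close> and \<open>d\<close> admit norm-one
  projections in every norm.

  The norm is given by the body \<open>|x|\<^sup>2 + (\<Sum>j<d. |f\<^sub>j x| powr (1 +
  q\<^sub>j)) \<le> 1\<close> with \<open>f\<^sub>0 = e\<^sub>0\<close>, \<open>f\<^sub>j =
  e\<^sub>0 + e\<^sub>j\<close> and distinct \<open>q\<^sub>j\<close> strictly between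
  \<open>0\<close> and \<open>1\<close>. If \<open>P\<close> has norm one, then at each boundary
  point in its range \<open>V\<close> the gradient of the left-hand side annihilates the kernel
  \<open>W\<close> (\<open>contact_annihilates_kernel\<close>). The \<open>j\<close>-th summand
  contributes a singularity of order \<open>q\<^sub>j\<close> to this gradient where
  \<open>f\<^sub>j\<close> vanishes. If \<open>V\<close> has dimension at least \<open>2\<close>
  it meets that hyperplane away from \<open>0\<close>, and as the orders are distinct the
  singularities cannot cancel each other; so \<open>f\<^sub>j\<close> vanishes on
  \<open>V\<close> or on \<open>W\<close> (\<open>singular_separation\<close>). Once these terms
  are gone, the quadratic term shows that \<open>V\<close> and \<open>W\<close> are orthogonal.
  Each \<open>f\<^sub>j\<close> then lies in \<open>V\<close> or in \<open>W\<close>; since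
  \<open>f\<^sub>0\<close> is orthogonal to none of them, all lie in the same one, which is
  therefore the whole space (\<open>trace_of_contractive_projection\<close>).

  Vectors are functions of which only the values below \<open>d\<close> matter, and projections
  are arrays \<open>nat \<Rightarrow> nat \<Rightarrow> real\<close>. This keeps the dimension a
  variable and makes the product topology available for the compactness argument.\<close>

section \<open>Vectors as functions and bilinear algebra\<close>

definition dot :: "nat \<Rightarrow> (nat \<Rightarrow> real) \<Rightarrow> (nat \<Rightarrow> real) \<Rightarrow> real" where
  "dot d x y = (\<Sum>i<d. x i * y i)"

definition app :: "nat \<Rightarrow> (nat \<Rightarrow> nat \<Rightarrow> real) \<Rightarrow> (nat \<Rightarrow> real) \<Rightarrow> nat \<Rightarrow> real" where
  "app d P x = (\<lambda>i. \<Sum>k<d. P i k * x k)"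

lemma dot_commute: "dot d x y = dot d y x"
  by (simp add: dot_def mult.commute)

lemma dot_add_right: "dot d f (\<lambda>i. x i + y i) = dot d f x + dot d f y"
  by (simp add: dot_def distrib_left sum.distrib)

lemma dot_diff_right: "dot d f (\<lambda>i. x i - y i) = dot d f x - dot d f y"
  by (simp add: dot_def right_diff_distrib sum_subtractf)

lemma dot_scale_right: "dot d f (\<lambda>i. c * x i) = c * dot d f x"
  by (simp add: dot_def sum_distrib_left mult.left_commute)

lemma dot_add_left: "dot d (\<lambda>i. x i + y i) f = dot d x f + dot d y f"
  by (simp add: dot_def distrib_right sum.distrib)

lemma dot_diff_left: "dot d (\<lambda>i. x i - y i) f = dot d x f - dot d y f"
  by (simp add: dot_def left_diff_distrib sum_subtractf)

lemma dot_scale_left: "dot d (\<lambda>i. c * x i) f = c * dot d x f"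
  by (simp add: dot_def sum_distrib_left mult.assoc)

lemma dot_divide_left: "dot d (\<lambda>i. x i / c) f = dot d x f / c"
  by (simp add: dot_def sum_divide_distrib)

lemma dot_divide_right: "dot d f (\<lambda>i. x i / c) = dot d f x / c"
  by (simp add: dot_def sum_divide_distrib)

lemmas dot_linear = dot_add_right dot_diff_right dot_scale_right
  dot_add_left dot_diff_left dot_scale_left
  dot_divide_left dot_divide_right

lemma dot_self_nonneg: "0 \<le> dot d x x"
  by (simp add: dot_def sum_nonneg)

lemma dot_self_eq_0: "dot d x x = 0 \<longleftrightarrow> (\<forall>i<d. x i = 0)"
  unfolding dot_def by (subst sum_nonneg_eq_0_iff) auto

lemma dot_cong: "(\<And>i. i < d \<Longrightarrow> x i = y i) \<Longrightarrow> dot d f x = dot d f y"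
  by (simp add: dot_def)

lemma dot_cong_left: "(\<And>i. i < d \<Longrightarrow> x i = y i) \<Longrightarrow> dot d x f = dot d y f"
  by (simp add: dot_def)

lemma app_add: "app d P (\<lambda>i. x i + y i) = (\<lambda>i. app d P x i + app d P y i)"
  by (simp add: app_def distrib_left sum.distrib)

lemma app_diff: "app d P (\<lambda>i. x i - y i) = (\<lambda>i. app d P x i - app d P y i)"
  by (simp add: app_def right_diff_distrib sum_subtractf)

lemma app_scale: "app d P (\<lambda>i. c * x i) = (\<lambda>i. c * app d P x i)"
  by (simp add: app_def sum_distrib_left mult.left_commute)

lemmas app_linear = app_add app_diff app_scale

section \<open>Signed powers\<close>

definition signed_powr :: "real \<Rightarrow> real \<Rightarrow> real" where
  "signed_powr q t = sgn t * \<bar>t\<bar> powr q"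

lemma signed_powr_0 [simp]: "signed_powr q 0 = 0"
  by (simp add: signed_powr_def)

lemma signed_powr_eq_0_iff [simp]: "signed_powr q t = 0 \<longleftrightarrow> t = 0"
  by (simp add: signed_powr_def sgn_zero_iff)

lemma signed_powr_times: "signed_powr q t * t = \<bar>t\<bar> powr (1 + q)"
  by (cases "t = 0") (auto simp: signed_powr_def powr_add abs_mult_self_eq sgn_real_def abs_if)

lemma signed_powr_scale: "c > 0 \<Longrightarrow> signed_powr q (c * t) = c powr q * signed_powr q t"
  by (simp add: signed_powr_def abs_mult powr_mult sgn_mult)

lemma powr_tendsto_0_at_right:
  "0 < q \<Longrightarrow> ((\<lambda>s::real. s powr q) \<longlongrightarrow> 0) (at_right 0)"
  by (intro tendsto_zero_powrI[where b = q] tendsto_ident_at tendsto_const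
        eventually_mono[OF eventually_at_right_less]) auto

lemma continuous_signed_powr: 
  assumes "q > 0" shows "continuous_on UNIV (signed_powr q)"
proof -
  have "signed_powr q = (\<lambda>t. max t 0 powr q - max (-t) 0 powr q)"
    using assms by (auto simp: signed_powr_def fun_eq_iff sgn_real_def max_def)
  moreover have "continuous_on UNIV (\<lambda>t::real. max t 0 powr q - max (-t) 0 powr q)"
    using assms by (intro continuous_intros continuous_on_powr') auto
  ultimately show ?thesis by simp
qed

lemma signed_powr_deriv:
  assumes "c \<noteq> 0" shows "\<exists>D. (signed_powr q has_real_derivative D) (at c)"
proof (cases "c > 0")
  case True
  have "((\<lambda>t. t powr q) has_real_derivative q * c powr (q - 1)) (at c)"
    using True by (rule has_real_derivative_powr)
  then have "(signed_powr q has_real_derivative q * c powr (q - 1)) (at c)"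
    by (rule has_field_derivative_transform_within_open[where S="{0<..}"])
       (use True in \<open>auto simp: signed_powr_def\<close>)
  then show ?thesis by blast
next
  case False
  then have c: "c < 0" using assms by simp
  have "((\<lambda>t. - ((- t) powr q)) has_real_derivative q * (- c) powr (q - 1)) (at c)"
    using c by (auto intro!: derivative_eq_intros)
  then have "(signed_powr q has_real_derivative q * (- c) powr (q - 1)) (at c)"
    by (rule has_field_derivative_transform_within_open[where S="{..<0}"])
       (use c in \<open>auto simp: signed_powr_def\<close>)
  then show ?thesis by blast
qed

text \<open>Convexity of \<open>|t| powr (1 + q)\<close>, in the form of a tangent line. It
  amounts to Young's inequality for \<open>|a| powr q * |b|\<close>.\<close>

lemma abs_powr_tangent:
  assumes "q > 0"
  shows "\<bar>a\<bar> powr (1 + q) + (1 + q) * signed_powr q a * (b - a) \<le> \<bar>b\<bar> powr (1 + q)"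
proof -
  define p where "p = 1 + q"
  have p: "p > 1" "q = p - 1" using assms by (auto simp: p_def)
  have "signed_powr q a * b \<le> \<bar>signed_powr q a * b\<bar>" by (rule abs_ge_self)
  also have "\<dots> = \<bar>a\<bar> powr q * \<bar>b\<bar>"
    by (cases "a = 0") (simp_all add: signed_powr_def abs_mult abs_sgn_eq)
  also have "\<dots> \<le> (\<bar>a\<bar> powr q) powr (p/q) / (p/q) + \<bar>b\<bar> powr p / p"
    using p assms by (intro Youngs_inequality) (auto simp: field_simps)
  also have "(\<bar>a\<bar> powr q) powr (p/q) = \<bar>a\<bar> powr p"
    using assms by (simp add: powr_powr)
  finally have "p * (signed_powr q a * b) \<le> p * (\<bar>a\<bar> powr p / (p/q) + \<bar>b\<bar> powr p / p)"
    using p by (intro mult_left_mono) auto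
  also have "\<dots> = q * \<bar>a\<bar> powr p + \<bar>b\<bar> powr p"
    using p assms by (simp add: field_simps)
  finally have "p * (signed_powr q a * b) \<le> q * \<bar>a\<bar> powr p + \<bar>b\<bar> powr p" .
  moreover have "signed_powr q a * a = \<bar>a\<bar> powr p" by (simp add: signed_powr_times p_def)
  ultimately have "\<bar>a\<bar> powr p + p * (signed_powr q a * b - signed_powr q a * a) \<le> \<bar>b\<bar> powr p"
    unfolding right_diff_distrib p(2) by (simp add: algebra_simps)
  then show ?thesis by (simp add: p_def algebra_simps)
qed

section \<open>The convex body and its polar\<close>

text \<open>The exponents must be pairwise distinct and lie strictly between \<open>0\<close> and
  \<open>1\<close>: below \<open>1\<close> so that \<open>signed_powr (exponent j)\<close> has
  infinite slope at \<open>0\<close>, distinct so that the singularities of different summands of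
  the energy can be told apart by their order.\<close>

definition exponent :: "nat \<Rightarrow> real" where "exponent j = (real j + 1) / (real j + 2)"

text \<open>The vectors \<open>e\<^sub>0, e\<^sub>0 + e\<^sub>1, \<dots>, e\<^sub>0 +
  e\<^bsub>d-1\<^esub>\<close>. They span the space, and none of them is orthogonal to the first;
  hence no orthogonal splitting of the space distributes them over two proper summands.\<close>

definition star_vec :: "nat \<Rightarrow> nat \<Rightarrow> real" where
  "star_vec j = (\<lambda>i. if i = 0 \<or> i = j then 1 else 0)"

abbreviation star_form :: "nat \<Rightarrow> nat \<Rightarrow> (nat \<Rightarrow> real) \<Rightarrow> real" where
  "star_form d j x \<equiv> dot d (star_vec j) x"

lemma exponent_bounds: "0 < exponent j" "exponent j < 1"
  by (auto simp: exponent_def field_simps)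

lemma exponent_mono: "i < j \<Longrightarrow> exponent i < exponent j"
  by (simp add: exponent_def field_simps)

text \<open>The unit body of the construction is \<open>{x. energy d x \<le> 1}\<close>. The
  quadratic part makes it strictly convex; the remaining part makes its boundary fail to be twice
  differentiable exactly along the hyperplanes orthogonal to the vectors \<open>star_vec
  j\<close>.\<close>

definition energy :: "nat \<Rightarrow> (nat \<Rightarrow> real) \<Rightarrow> real" where
  "energy d x = dot d x x + (\<Sum>j<d. \<bar>star_form d j x\<bar> powr (1 + exponent j))"

definition energy_gradient :: "nat \<Rightarrow> (nat \<Rightarrow> real) \<Rightarrow> nat \<Rightarrow> real" where
  "energy_gradient d x = (\<lambda>i. 2 * x i + (\<Sum>j<d. (1 + exponent j) * signed_powr (exponent j) (star_form d j x) * star_vec j i))"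

definition polar :: "nat \<Rightarrow> (nat \<Rightarrow> real) set" where
  "polar d = {f. \<forall>x. energy d x \<le> 1 \<longrightarrow> dot d f x \<le> 1}"

lemma dot_energy_gradient:
  "dot d (energy_gradient d x) y = 2 * dot d x y + 
     (\<Sum>j<d. (1 + exponent j) * signed_powr (exponent j) (star_form d j x) * star_form d j y)"
proof -
  have "dot d (\<lambda>i. \<Sum>j<d. (1 + exponent j) * signed_powr (exponent j) (star_form d j x) * star_vec j i) y
     = (\<Sum>j<d. (1 + exponent j) * signed_powr (exponent j) (star_form d j x) * star_form d j y)"
    unfolding dot_def sum_distrib_right sum_distrib_left
    by (subst sum.swap) (simp add: mult.assoc)
  then show ?thesis
    unfolding energy_gradient_def by (simp add: dot_linear)
qed

lemma energy_tangent: "energy d x + dot d (energy_gradient d x) (\<lambda>i. y i - x i) \<le> energy d y"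
proof -
  have "0 \<le> dot d (\<lambda>i. y i - x i) (\<lambda>i. y i - x i)" by (rule dot_self_nonneg)
  then have 1: "dot d x x + 2 * dot d x (\<lambda>i. y i - x i) \<le> dot d y y"
    by (simp add: dot_linear dot_commute algebra_simps)
  have 2: "(\<Sum>j<d. \<bar>star_form d j x\<bar> powr (1 + exponent j)
       + (1 + exponent j) * signed_powr (exponent j) (star_form d j x) * (star_form d j y - star_form d j x))
      \<le> (\<Sum>j<d. \<bar>star_form d j y\<bar> powr (1 + exponent j))"
    by (intro sum_mono abs_powr_tangent exponent_bounds)
  show ?thesis
    unfolding dot_energy_gradient energy_def using 1 2
    by (simp add: dot_linear sum.distrib)
qed

lemma energy_uminus: "energy d (\<lambda>i. - x i) = energy d x"
  using dot_scale_right[of d _ "-1" x] dot_scale_left[of d "-1" x] by (simp add: energy_def)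

lemma energy_nonneg: "0 \<le> energy d x"
  unfolding energy_def by (intro add_nonneg_nonneg dot_self_nonneg sum_nonneg) auto

text \<open>All exponents in the energy are at most \<open>2\<close>. This lets a point of energy
  below \<open>1\<close> be stretched a little without leaving the body.\<close>

lemma energy_scale_le:
  assumes "1 \<le> c" shows "energy d (\<lambda>i. c * x i) \<le> c\<^sup>2 * energy d x"
proof -
  have "c powr (1 + exponent j) \<le> c\<^sup>2" for j
    using powr_mono[of "1 + exponent j" 2 c] assms exponent_bounds(2)[of j] by simp
  then show ?thesis using assms
    unfolding energy_def
    by (auto simp: dot_linear abs_mult powr_mult distrib_left sum_distrib_left power2_eq_square
        intro!: sum_mono mult_right_mono)
qed

lemma continuous_energy_ray: "continuous_on UNIV (\<lambda>c. energy d (\<lambda>i. c * x i))"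
  unfolding energy_def dot_linear
  by (intro continuous_intros continuous_on_powr') (use exponent_bounds in \<open>auto simp: add_pos_pos add_nonneg_eq_0_iff less_imp_le\<close>)

lemma energy_gradient_self_ge: "energy d x \<le> dot d (energy_gradient d x) x"
proof -
  have "(\<Sum>j<d. \<bar>star_form d j x\<bar> powr (1 + exponent j)) \<le> 
     (\<Sum>j<d. (1 + exponent j) * signed_powr (exponent j) (star_form d j x) * star_form d j x)"
    by (intro sum_mono) (simp add: mult.assoc signed_powr_times less_imp_le[OF exponent_bounds(1)] distrib_right)
  then show ?thesis unfolding dot_energy_gradient energy_def using dot_self_nonneg[of d x] by simp
qed

lemma polar_bound:
  assumes "f \<in> polar d" "energy d x \<le> 1" shows "\<bar>dot d f x\<bar> \<le> 1"
proof -
  have "dot d f (\<lambda>i. - x i) \<le> 1" "dot d f x \<le> 1" using assms by (auto simp: polar_def energy_uminus)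
  then show ?thesis using dot_scale_right[of d f "-1" x] by simp
qed

text \<open>The number \<open>\<rho>\<close> is the norm of \<open>x\<close> for which the body
  is the unit ball; along a ray the energy grows continuously from \<open>0\<close> and dominates
  a positive quadratic.\<close>

lemma gauge_exists:
  assumes "dot d x x \<noteq> 0"
  shows "\<exists>\<rho>>0. energy d (\<lambda>i. x i / \<rho>) = 1"
proof -
  define a where "a = dot d x x"
  have a: "a > 0" using assms dot_self_nonneg[of d x] by (simp add: a_def)
  define g where "g c = energy d (\<lambda>i. c * x i)" for c
  have cg: "continuous_on UNIV g" unfolding g_def by (rule continuous_energy_ray)
  have g0: "g 0 = 0" by (simp add: g_def energy_def dot_def)
  define R where "R = 1 / sqrt a"
  have "R^2 * a = 1" using a by (simp add: R_def field_simps)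
  moreover have "R^2 * a \<le> g R"
    by (simp add: g_def energy_def dot_linear a_def power2_eq_square sum_nonneg)
  ultimately have gR: "1 \<le> g R" by simp
  have R: "0 \<le> R" using a by (simp add: R_def)
  obtain c where c: "0 \<le> c" "g c = 1"
    using IVT'[of g 0 1 R] g0 gR R continuous_on_subset[OF cg] by auto
  have "c \<noteq> 0" using c g0 by auto
  then show ?thesis using c by (intro exI[of _ "1/c"]) (auto simp: g_def mult.commute)
qed

text \<open>By the tangent inequality the gradient at a boundary point \<open>z\<close> is
  largest over the body at \<open>z\<close> itself, so rescaling it gives a functional of the
  polar that attains its bound at \<open>z\<close>.\<close>

lemma contact_functional:
  assumes "energy d z = 1"
  shows "dot d (energy_gradient d z) z \<ge> 1"
    and "(\<lambda>i. energy_gradient d z i / dot d (energy_gradient d z) z) \<in> polar d"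
proof -
  show 1: "dot d (energy_gradient d z) z \<ge> 1" using energy_gradient_self_ge[of d z] assms by simp
  have "dot d (\<lambda>i. energy_gradient d z i / dot d (energy_gradient d z) z) x \<le> 1" if "energy d x \<le> 1" for x
  proof -
    have "dot d (energy_gradient d z) x \<le> dot d (energy_gradient d z) z"
      using energy_tangent[of d z x] that assms by (simp add: dot_linear)
    then show ?thesis using 1 by (simp add: dot_divide_left)
  qed
  then show "(\<lambda>i. energy_gradient d z i / dot d (energy_gradient d z) z) \<in> polar d"
    by (simp add: polar_def)
qed

text \<open>The first-order condition at a minimum. Applying the tangent inequality at the
  displaced point shows that \<open>t\<close> times the directional derivative there is
  nonnegative; by continuity of the gradient the derivative at \<open>t = 0\<close> vanishes.\<close>

lemma energy_stationary:
  assumes min: "\<And>t. 1 \<le> energy d (\<lambda>i. v i + t * w i)" and v: "energy d v = 1"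
  shows "dot d (energy_gradient d v) w = 0"
proof -
  define h where "h t = dot d (energy_gradient d (\<lambda>i. v i + t * w i)) w" for t
  have th: "0 \<le> t \<and> 0 \<le> h t \<or> t \<le> 0 \<and> h t \<le> 0" for t
    unfolding zero_le_mult_iff[symmetric]
    using energy_tangent[of d "\<lambda>i. v i + t * w i" v] min[of t] v
    using dot_scale_right[of d _ "-t" w] by (simp add: h_def dot_linear)
  have "continuous_on UNIV h"
    unfolding h_def dot_energy_gradient dot_linear
    by (intro continuous_intros continuous_on_compose2[OF continuous_signed_powr]) (auto simp: exponent_bounds)
  then have lim: "(h \<longlongrightarrow> h 0) (at 0)" by (simp add: continuous_on_def)
  have "h 0 \<ge> 0"
  proof (rule tendsto_lowerbound)
    show "(h \<longlongrightarrow> h 0) (at_right 0)" using lim by (simp add: filterlim_at_split)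
    show "\<forall>\<^sub>F t in at_right 0. 0 \<le> h t"
      by (rule eventually_at_rightI[of 0 1]) (use th in \<open>force+\<close>)
  qed simp
  moreover have "h 0 \<le> 0"
  proof (rule tendsto_upperbound)
    show "(h \<longlongrightarrow> h 0) (at_left 0)" using lim by (simp add: filterlim_at_split)
    show "\<forall>\<^sub>F t in at_left 0. h t \<le> 0"
      by (rule eventually_at_leftI[of "-1" 0]) (use th in \<open>force+\<close>)
  qed simp
  ultimately show ?thesis by (simp add: h_def)
qed

section \<open>What a contractive projection forces\<close>

text \<open>Suppose that \<open>P\<close> maps the body into itself, which is here expressed by
  testing against the polar. A point \<open>v + t w\<close> with \<open>v\<close> in the range
  and \<open>w\<close> in the kernel is mapped to \<open>v\<close>, so it cannot lie in the
  interior of the body when \<open>v\<close> is a boundary point. Hence the energy along this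
  line is minimal at \<open>v\<close>, and the gradient at \<open>v\<close> annihilates the
  kernel.\<close>

lemma contact_annihilates_kernel:
  assumes nb: "\<And>x f. energy d x \<le> 1 \<Longrightarrow> f \<in> polar d \<Longrightarrow> dot d f (app d P x) \<le> 1"
    and v: "energy d v = 1" "\<And>i. i < d \<Longrightarrow> app d P v i = v i"
    and w: "\<And>i. i < d \<Longrightarrow> app d P w i = 0"
  shows "dot d (energy_gradient d v) w = 0"
proof (rule energy_stationary[OF _ v(1)])
  fix t
  define x where "x = (\<lambda>i. v i + t * w i)"
  show "1 \<le> energy d (\<lambda>i. v i + t * w i)"
  proof (rule ccontr)
    assume "\<not> ?thesis"
    then have lt: "energy d x < 1" by (simp add: x_def)
    \<comment> \<open>With this factor, \<open>c\<^sup>2 * energy d x \<le> 1\<close> although \<open>c > 1\<close>.\<close>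
    define c where "c = sqrt (2 / (1 + energy d x))"
    have g0: "0 \<le> energy d x" by (rule energy_nonneg)
    have c: "c > 1" using lt g0 by (simp add: c_def)
    have "c\<^sup>2 * energy d x \<le> 1" using lt g0 by (simp add: c_def field_simps)
    then have "energy d (\<lambda>i. c * x i) \<le> 1" using energy_scale_le[of c d x] c by simp
    moreover define f where "f = (\<lambda>i. energy_gradient d v i / dot d (energy_gradient d v) v)"
    ultimately have "dot d f (app d P (\<lambda>i. c * x i)) \<le> 1"
      using nb contact_functional(2)[OF v(1)] by blast
    moreover have "dot d f (app d P (\<lambda>i. c * x i)) = dot d f (\<lambda>i. c * v i)"
      by (intro dot_cong) (simp add: app_linear x_def v w)
    moreover have "dot d f v = 1"
      using contact_functional(1)[OF v(1)] by (simp add: f_def dot_divide_left)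
    ultimately show False using c by (simp add: dot_linear)
  qed
qed

section \<open>Separating singularities of different order\<close>

text \<open>A one-sided Lipschitz condition at the single point \<open>0\<close>. It suffices to
  make increments negligible against every power \<open>s powr q\<close> with \<open>q <
  1\<close>, is stable under the algebraic operations, and holds for the gauge, whose
  differentiability would need a separate argument.\<close>

definition lipschitz_at_0 :: "(real \<Rightarrow> real) \<Rightarrow> bool" where
  "lipschitz_at_0 h \<longleftrightarrow> (\<exists>K\<ge>0. \<forall>\<^sub>F s in at_right 0. \<bar>h s - h 0\<bar> \<le> K * s)"

lemma lipschitz_at_0_tendsto:
  assumes "lipschitz_at_0 h" shows "(h \<longlongrightarrow> h 0) (at_right 0)"
proof -
  obtain K where "\<forall>\<^sub>F s in at_right 0. norm (h s - h 0) \<le> K * s"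
    using assms by (auto simp: lipschitz_at_0_def)
  moreover have "((\<lambda>s. K * s) \<longlongrightarrow> 0) (at_right 0)"
    by (rule tendsto_mult_right_zero) (rule tendsto_ident_at)
  ultimately have "((\<lambda>s. h s - h 0) \<longlongrightarrow> 0) (at_right 0)"
    by (rule Lim_null_comparison)
  then show ?thesis by (simp add: LIM_zero_iff)
qed

lemma lipschitz_at_0_quotient_tendsto_0:
  assumes "lipschitz_at_0 h" "q < 1"
  shows "((\<lambda>s. (h s - h 0) / s powr q) \<longlongrightarrow> 0) (at_right 0)"
proof -
  obtain K where K: "\<forall>\<^sub>F s in at_right 0. \<bar>h s - h 0\<bar> \<le> K * s"
    using assms by (auto simp: lipschitz_at_0_def)
  have "((\<lambda>s::real. s powr (1 - q)) \<longlongrightarrow> 0) (at_right 0)"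
    using assms(2) by (intro powr_tendsto_0_at_right) simp
  then have "((\<lambda>s. K * s powr (1 - q)) \<longlongrightarrow> 0) (at_right 0)"
    by (rule tendsto_mult_right_zero)
  moreover have "\<forall>\<^sub>F s in at_right 0. norm ((h s - h 0) / s powr q) \<le> K * s powr (1 - q)"
    using K eventually_at_right_less[of 0]
  proof eventually_elim
    case (elim s)
    then have "\<bar>h s - h 0\<bar> / s powr q \<le> K * s / s powr q"
      by (intro divide_right_mono) auto
    then show ?case using elim by (simp add: powr_diff)
  qed
  ultimately show ?thesis by (rule Lim_null_comparison[rotated])
qed

lemma lipschitz_at_0_affine: "lipschitz_at_0 (\<lambda>s. a + s * b)"
  unfolding lipschitz_at_0_def
  by (intro exI[of _ "\<bar>b\<bar>"] conjI eventually_mono[OF eventually_at_right_less])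
     (auto simp: abs_mult)

lemma lipschitz_at_0_const: "lipschitz_at_0 (\<lambda>s. a)"
  using lipschitz_at_0_affine[of a 0] by simp

lemma lipschitz_at_0_add:
  assumes "lipschitz_at_0 g" "lipschitz_at_0 h" shows "lipschitz_at_0 (\<lambda>s. g s + h s)"
proof -
  obtain K L where K: "K \<ge> 0" "\<forall>\<^sub>F s in at_right 0. \<bar>g s - g 0\<bar> \<le> K * s"
    and L: "L \<ge> 0" "\<forall>\<^sub>F s in at_right 0. \<bar>h s - h 0\<bar> \<le> L * s"
    using assms by (auto simp: lipschitz_at_0_def)
  have "\<forall>\<^sub>F s in at_right 0. \<bar>(g s + h s) - (g 0 + h 0)\<bar> \<le> (K + L) * s"
    using K(2) L(2) by eventually_elim (simp add: distrib_right)
  then show ?thesis unfolding lipschitz_at_0_def using K(1) L(1) by (intro exI[of _ "K+L"]) auto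
qed

lemma lipschitz_at_0_mult:
  assumes "lipschitz_at_0 g" "lipschitz_at_0 h" shows "lipschitz_at_0 (\<lambda>s. g s * h s)"
proof -
  obtain K L where K: "K \<ge> 0" "\<forall>\<^sub>F s in at_right 0. \<bar>g s - g 0\<bar> \<le> K * s"
    and L: "L \<ge> 0" "\<forall>\<^sub>F s in at_right 0. \<bar>h s - h 0\<bar> \<le> L * s"
    using assms by (auto simp: lipschitz_at_0_def)
  have bd: "\<forall>\<^sub>F s in at_right 0. \<bar>h s\<bar> < \<bar>h 0\<bar> + 1"
    using tendsto_rabs[OF lipschitz_at_0_tendsto[OF assms(2)]] by (rule order_tendstoD(2)) simp
  have "\<forall>\<^sub>F s in at_right 0. \<bar>g s * h s - g 0 * h 0\<bar> \<le> (K * (\<bar>h 0\<bar> + 1) + \<bar>g 0\<bar> * L) * s"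
    using K(2) L(2) bd eventually_at_right_less[of 0]
  proof eventually_elim
    case (elim s)
    have "\<bar>g s * h s - g 0 * h 0\<bar> = \<bar>(g s - g 0) * h s + g 0 * (h s - h 0)\<bar>"
      by (simp add: algebra_simps)
    also have "\<dots> \<le> \<bar>g s - g 0\<bar> * \<bar>h s\<bar> + \<bar>g 0\<bar> * \<bar>h s - h 0\<bar>"
      using abs_triangle_ineq by (metis abs_mult)
    also have "\<dots> \<le> (K * s) * (\<bar>h 0\<bar> + 1) + \<bar>g 0\<bar> * (L * s)"
      using elim K(1) by (intro add_mono mult_mono) auto
    finally show ?case by (simp add: algebra_simps)
  qed
  then show ?thesis unfolding lipschitz_at_0_def using K(1) L(1)
    by (intro exI[of _ "K * (\<bar>h 0\<bar> + 1) + \<bar>g 0\<bar> * L"]) auto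
qed

lemma lipschitz_at_0_sum:
  assumes "\<And>j. j \<in> A \<Longrightarrow> lipschitz_at_0 (h j)" shows "lipschitz_at_0 (\<lambda>s. \<Sum>j\<in>A. h j s)"
  using assms by (induction A rule: infinite_finite_induct) (auto intro: lipschitz_at_0_const lipschitz_at_0_add)

lemma lipschitz_at_0_compose:
  assumes h: "lipschitz_at_0 h" and D: "(\<phi> has_real_derivative D) (at (h 0))"
  shows "lipschitz_at_0 (\<lambda>s. \<phi> (h s))"
proof -
  define c where "c = h 0"
  obtain K where K: "K \<ge> 0" "\<forall>\<^sub>F s in at_right 0. \<bar>h s - c\<bar> \<le> K * s"
    using h by (auto simp: lipschitz_at_0_def c_def)
  have "((\<lambda>x. \<bar>(\<phi> (c + x) - \<phi> c) / x\<bar>) \<longlongrightarrow> \<bar>D\<bar>) (at 0)"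
    using D by (intro tendsto_rabs) (simp add: DERIV_def c_def)
  then have "\<forall>\<^sub>F x in at 0. \<bar>(\<phi> (c + x) - \<phi> c) / x\<bar> < \<bar>D\<bar> + 1"
    by (rule order_tendstoD(2)) simp
  then obtain \<delta> where \<delta>: "\<delta> > 0" 
    "\<And>x. x \<noteq> 0 \<Longrightarrow> \<bar>x\<bar> < \<delta> \<Longrightarrow> \<bar>(\<phi> (c + x) - \<phi> c) / x\<bar> < \<bar>D\<bar> + 1"
    by (auto simp: eventually_at)
  have est: "\<bar>\<phi> (c + x) - \<phi> c\<bar> \<le> (\<bar>D\<bar> + 1) * \<bar>x\<bar>" if "\<bar>x\<bar> < \<delta>" for x
    using \<delta>(2)[of x] that by (cases "x = 0") (auto simp: abs_divide field_simps)
  have "((\<lambda>s. \<bar>h s - c\<bar>) \<longlongrightarrow> 0) (at_right 0)"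
    using lipschitz_at_0_tendsto[OF h] by (simp add: c_def tendsto_rabs_zero_iff LIM_zero_iff)
  then have "\<forall>\<^sub>F s in at_right 0. \<bar>h s - c\<bar> < \<delta>"
    using \<delta>(1) by (rule order_tendstoD(2))
  with K(2) have "\<forall>\<^sub>F s in at_right 0. \<bar>\<phi> (h s) - \<phi> c\<bar> \<le> ((\<bar>D\<bar> + 1) * K) * s"
  proof eventually_elim
    case (elim s)
    have "\<bar>\<phi> (h s) - \<phi> c\<bar> \<le> (\<bar>D\<bar> + 1) * \<bar>h s - c\<bar>" using est[of "h s - c"] elim by simp
    also have "\<dots> \<le> (\<bar>D\<bar> + 1) * (K * s)" using elim by (intro mult_left_mono) auto
    finally show ?case by (simp add: mult.assoc)
  qed
  then show ?thesis unfolding lipschitz_at_0_def c_def using K(1)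
    by (intro exI[of _ "(\<bar>D\<bar> + 1) * K"]) auto
qed

text \<open>The triangle inequality for the gauge, read off from the contact functional at the
  boundary point \<open>(x + s u) / \<sigma>\<close>.\<close>

lemma gauge_perturb:
  assumes "\<rho> > 0" "energy d (\<lambda>i. x i / \<rho>) = 1" "\<sigma> > 0" "energy d (\<lambda>i. (x i + s * u i) / \<sigma>) = 1"
    and "m > 0" "energy d (\<lambda>i. u i / m) = 1"
  shows "\<sigma> \<le> \<rho> + m * \<bar>s\<bar>"
proof -
  define z where "z = (\<lambda>i. (x i + s * u i) / \<sigma>)"
  define f where "f = (\<lambda>i. energy_gradient d z i / dot d (energy_gradient d z) z)"
  have z: "energy d z = 1" using assms(4) by (simp add: z_def)
  have f: "f \<in> polar d" using contact_functional(2)[OF z] by (simp add: f_def)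
  have fz: "dot d f z = 1" using contact_functional(1)[OF z] by (simp add: f_def dot_divide_left)
  have "dot d f x \<le> \<rho>"
    using polar_bound[OF f, of "\<lambda>i. x i / \<rho>"] assms by (simp add: dot_linear field_simps)
  moreover have "\<bar>dot d f u\<bar> \<le> m"
    using polar_bound[OF f, of "\<lambda>i. u i / m"] assms by (simp add: dot_linear abs_divide field_simps)
  then have "\<bar>s\<bar> * \<bar>dot d f u\<bar> \<le> \<bar>s\<bar> * m" by (intro mult_left_mono) auto
  then have "s * dot d f u \<le> m * \<bar>s\<bar>"
    by (simp add: abs_mult[symmetric] mult.commute)
  moreover have "\<sigma> = dot d f x + s * dot d f u"
    using fz assms(3) by (simp add: z_def dot_linear field_simps)
  ultimately show ?thesis by simp
qed

text \<open>The heart of the argument. Let \<open>v \<noteq> 0\<close> lie on the hyperplane of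
  \<open>star_vec k\<close> and let \<open>u\<close> be transversal to it. Move along \<open>v +
  s u\<close>, normalised to the boundary of the body, and look at the identity \<open>gradient
  \<cdot> w = 0\<close> as \<open>s\<close> decreases to \<open>0\<close>. Summands
  \<open>j\<close> with \<open>star_vec j\<close> not orthogonal to \<open>v\<close> are
  Lipschitz in \<open>s\<close>; each of the others is \<open>s powr exponent j\<close> times a
  function with a limit, and that limit is a nonzero multiple of \<open>star_form d j w\<close>
  whenever \<open>star_form d j u \<noteq> 0\<close>. Since the exponents are distinct and below
  \<open>1\<close>, the nonzero term of lowest order could not be cancelled by anything else.\<close>

lemma singular_separation:
  assumes ident: "\<And>s \<rho>. 0 \<le> s \<Longrightarrow> 0 < \<rho> \<Longrightarrow> energy d (\<lambda>i. (v i + s * u i) / \<rho>) = 1 \<Longrightarrow>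
      dot d (energy_gradient d (\<lambda>i. (v i + s * u i) / \<rho>)) w = 0"
    and v: "dot d v v \<noteq> 0" and k: "k < d" "star_form d k v = 0" "star_form d k u \<noteq> 0"
  shows "star_form d k w = 0"
proof (rule ccontr)
  assume kw: "star_form d k w \<noteq> 0"
  have nz: "dot d x x \<noteq> 0" if "star_form d k x \<noteq> 0" for x
    using that by (metis dot_self_eq_0 dot_cong[of d x "\<lambda>_. 0"] dot_scale_right[of d _ 0 "\<lambda>_. 0"] mult_zero_left)
  have "\<exists>\<rho>>0. energy d (\<lambda>i. (v i + s * u i) / \<rho>) = 1" for s
  proof (cases "s = 0")
    case True then show ?thesis using gauge_exists[OF v] by simp
  next
    case False
    then have "star_form d k (\<lambda>i. v i + s * u i) \<noteq> 0" using k by (simp add: dot_linear)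
    then show ?thesis by (intro gauge_exists nz)
  qed
  then obtain \<rho> where \<rho>: "\<And>s. \<rho> s > 0" "\<And>s. energy d (\<lambda>i. (v i + s * u i) / \<rho> s) = 1"
    by metis
  obtain m where m: "m > 0" "energy d (\<lambda>i. u i / m) = 1" using gauge_exists[OF nz[OF k(3)]] by blast
  have "\<bar>\<rho> s - \<rho> 0\<bar> \<le> m * s" if "s > 0" for s
  proof -
    have "\<rho> s \<le> \<rho> 0 + m * \<bar>s\<bar>"
      using \<rho>[of 0] \<rho>[of s] m by (intro gauge_perturb) auto
    moreover have "\<rho> 0 \<le> \<rho> s + m * \<bar>- s\<bar>"
      using \<rho>[of 0] \<rho>[of s] m
      by (intro gauge_perturb[where x = "\<lambda>i. v i + s * u i" and u = u and d = d]) (auto simp: algebra_simps)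
    ultimately show ?thesis using that by simp
  qed
  then have lipschitz_at_0\<rho>: "lipschitz_at_0 \<rho>" unfolding lipschitz_at_0_def
    using m(1) by (intro exI[of _ m] conjI eventually_mono[OF eventually_at_right_less]) auto
  have lip_div: "lipschitz_at_0 (\<lambda>s. 1 / \<rho> s)"
  proof (rule lipschitz_at_0_compose[OF lipschitz_at_0\<rho>])
    show "((\<lambda>x. 1 / x) has_real_derivative - 1 / (\<rho> 0)\<^sup>2) (at (\<rho> 0))"
      using \<rho>(1)[of 0] by (auto intro!: derivative_eq_intros simp: power2_eq_square)
  qed
  \<comment> \<open>The part of the gradient identity that is Lipschitz at \<open>0\<close>.\<close>
  define reg where "reg s = 2 * dot d (\<lambda>i. (v i + s * u i) / \<rho> s) w +
     (\<Sum>j\<in>{j. j < d \<and> star_form d j v \<noteq> 0}.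
         (1 + exponent j) * signed_powr (exponent j) (star_form d j (\<lambda>i. (v i + s * u i) / \<rho> s)) * star_form d j w)" for s
  have lin: "lipschitz_at_0 (\<lambda>s. dot d f (\<lambda>i. (v i + s * u i) / \<rho> s))" for f
    using lipschitz_at_0_mult[OF lipschitz_at_0_affine[of "dot d f v" "dot d f u"] lip_div] by (simp add: dot_linear)
  have "lipschitz_at_0 reg" unfolding reg_def
  proof (intro lipschitz_at_0_add lipschitz_at_0_mult lipschitz_at_0_sum lipschitz_at_0_const)
    show "lipschitz_at_0 (\<lambda>s. dot d (\<lambda>i. (v i + s * u i) / \<rho> s) w)"
      using lin[of w] by (simp add: dot_commute)
    fix j assume "j \<in> {j. j < d \<and> star_form d j v \<noteq> 0}"
    then have "star_form d j (\<lambda>i. (v i + 0 * u i) / \<rho> 0) \<noteq> 0" using \<rho>(1)[of 0] by (simp add: dot_linear)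
    from signed_powr_deriv[OF this] 
    show "lipschitz_at_0 (\<lambda>s. signed_powr (exponent j) (star_form d j (\<lambda>i. (v i + s * u i) / \<rho> s)))"
      using lipschitz_at_0_compose[OF lin[of "star_vec j"]] by blast
  qed
  define S where "S = {j. j < d \<and> star_form d j v = 0}"
  have split: "{..<d} = {j. j < d \<and> star_form d j v \<noteq> 0} \<union> S" "{j. j < d \<and> star_form d j v \<noteq> 0} \<inter> S = {}"
    by (auto simp: S_def)
  have ident': "reg s + (\<Sum>j\<in>S. (1 + exponent j) * (s powr exponent j * signed_powr (exponent j) (star_form d j u / \<rho> s)) * star_form d j w) = 0"
    if "s \<ge> 0" for s
  proof -
    have "signed_powr (exponent j) (star_form d j (\<lambda>i. (v i + s * u i) / \<rho> s)) 
        = s powr exponent j * signed_powr (exponent j) (star_form d j u / \<rho> s)" if "j \<in> S" for j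
    proof -
      have "star_form d j (\<lambda>i. (v i + s * u i) / \<rho> s) = s * (star_form d j u / \<rho> s)"
        using that by (simp add: dot_linear S_def)
      then show ?thesis using \<open>s \<ge> 0\<close> signed_powr_scale[of s _ "star_form d j u / \<rho> s"] by (cases "s = 0") auto
    qed
    then have "(\<Sum>j\<in>S. (1 + exponent j) * (s powr exponent j * signed_powr (exponent j) (star_form d j u / \<rho> s)) * star_form d j w)
       = (\<Sum>j\<in>S. (1 + exponent j) * signed_powr (exponent j) (star_form d j (\<lambda>i. (v i + s * u i) / \<rho> s)) * star_form d j w)"
      by (intro sum.cong) auto
    moreover have "dot d (energy_gradient d (\<lambda>i. (v i + s * u i) / \<rho> s)) w = 0"
      using ident[OF that \<rho>(1) \<rho>(2)] .
    ultimately show ?thesis unfolding dot_energy_gradient reg_def split(1)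
      by (subst (asm) sum.union_disjoint) (use split(2) in \<open>auto simp: S_def\<close>)
  qed
  have reg0: "reg 0 = 0" using ident'[of 0] by simp
  define T where "T = {j\<in>S. star_form d j u \<noteq> 0 \<and> star_form d j w \<noteq> 0}"
  have T: "finite T" "k \<in> T" using k kw by (auto simp: T_def S_def)
  \<comment> \<open>The exponents increase with the index, so this is the surviving term of lowest order.\<close>
  define i where "i = Min T"
  have i: "i \<in> T" unfolding i_def using T by (intro Min_in) auto
  have imin: "i \<le> j" if "j \<in> T" for j unfolding i_def using T that by (intro Min_le) auto
  define L where "L = (1 + exponent i) * signed_powr (exponent i) (star_form d i u / \<rho> 0) * star_form d i w"
  define quot where "quot j s = (1 + exponent j) * (s powr (exponent j - exponent i) * signed_powr (exponent j) (star_form d j u / \<rho> s)) * star_form d j w" for j s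
  have lim\<rho>: "((\<lambda>s. signed_powr (exponent j) (star_form d j u / \<rho> s)) \<longlongrightarrow> signed_powr (exponent j) (star_form d j u / \<rho> 0)) (at_right 0)" for j
  proof (rule isCont_tendsto_compose[of _ "signed_powr (exponent j)"])
    show "isCont (signed_powr (exponent j)) (star_form d j u / \<rho> 0)"
      using continuous_signed_powr[OF exponent_bounds(1)] by (simp add: continuous_on_eq_continuous_at)
    show "((\<lambda>s. star_form d j u / \<rho> s) \<longlongrightarrow> star_form d j u / \<rho> 0) (at_right 0)"
      using lipschitz_at_0_tendsto[OF lipschitz_at_0\<rho>] \<rho>(1)[of 0] by (intro tendsto_intros) auto
  qed
  have limterm: "(quot j \<longlongrightarrow> (if j = i then L else 0)) (at_right 0)" if "j \<in> S" for j
  proof (cases "j \<in> T")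
    case False
    then have "quot j = (\<lambda>s. 0)" using that by (auto simp: quot_def T_def)
    then show ?thesis using False i by auto
  next
    case True
    show ?thesis
    proof (cases "j = i")
      case True
      have "((\<lambda>s. (1 + exponent j) * (1 * signed_powr (exponent j) (star_form d j u / \<rho> s)) * star_form d j w) \<longlongrightarrow>
              (1 + exponent j) * (1 * signed_powr (exponent j) (star_form d j u / \<rho> 0)) * star_form d j w) (at_right 0)"
        by (intro tendsto_intros lim\<rho>)
      then have "((\<lambda>s. (1 + exponent j) * (1 * signed_powr (exponent j) (star_form d j u / \<rho> s)) * star_form d j w) \<longlongrightarrow> L) (at_right 0)"
        using True by (simp add: L_def)
      moreover have "\<forall>\<^sub>F s in at_right 0. (1 + exponent j) * (1 * signed_powr (exponent j) (star_form d j u / \<rho> s)) * star_form d j w = quot j s"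
        by (rule eventually_mono[OF eventually_at_right_less]) (simp add: quot_def True)
      ultimately show ?thesis using True by (auto intro: Lim_transform_eventually)
    next
      case False
      then have "exponent i < exponent j" using imin[OF True] by (intro exponent_mono) simp
      then have "((\<lambda>s::real. s powr (exponent j - exponent i)) \<longlongrightarrow> 0) (at_right 0)"
        by (intro powr_tendsto_0_at_right) simp
      then have "((\<lambda>s. (1 + exponent j) * (s powr (exponent j - exponent i) * signed_powr (exponent j) (star_form d j u / \<rho> s)) * star_form d j w)
          \<longlongrightarrow> (1 + exponent j) * (0 * signed_powr (exponent j) (star_form d j u / \<rho> 0)) * star_form d j w) (at_right 0)"
        by (intro tendsto_intros lim\<rho>)
      then show ?thesis using False by (simp add: quot_def[abs_def])
    qed
  qed
  have "((\<lambda>s. (reg s - reg 0) / s powr exponent i + (\<Sum>j\<in>S. quot j s)) \<longlongrightarrow> 0 + (\<Sum>j\<in>S. if j = i then L else 0)) (at_right 0)"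
    by (intro tendsto_add tendsto_sum limterm lipschitz_at_0_quotient_tendsto_0 \<open>lipschitz_at_0 reg\<close> exponent_bounds)
  moreover have "(\<Sum>j\<in>S. if j = i then L else 0) = L"
    using i by (subst sum.delta) (auto simp: T_def S_def)
  moreover have "\<forall>\<^sub>F s in at_right 0. (reg s - reg 0) / s powr exponent i + (\<Sum>j\<in>S. quot j s) = 0"
  proof (rule eventually_mono[OF eventually_at_right_less])
    fix s :: real assume s: "0 < s"
    have "(\<Sum>j\<in>S. quot j s) = (\<Sum>j\<in>S. (1 + exponent j) * (s powr exponent j * signed_powr (exponent j) (star_form d j u / \<rho> s)) * star_form d j w) / s powr exponent i"
      by (simp add: quot_def sum_divide_distrib powr_diff)
    then have "(reg s - reg 0) / s powr exponent i + (\<Sum>j\<in>S. quot j s) = 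
      (reg s + (\<Sum>j\<in>S. (1 + exponent j) * (s powr exponent j * signed_powr (exponent j) (star_form d j u / \<rho> s)) * star_form d j w)) / s powr exponent i"
      by (simp add: reg0 add_divide_distrib)
    then show "(reg s - reg 0) / s powr exponent i + (\<Sum>j\<in>S. quot j s) = 0"
      using ident'[of s] s by simp
  qed
  then have "((\<lambda>s. (reg s - reg 0) / s powr exponent i + (\<Sum>j\<in>S. quot j s)) \<longlongrightarrow> 0) (at_right 0)"
    by (rule tendsto_eventually)
  ultimately have "L = 0" using tendsto_unique[of "at_right (0::real)"] by force
  then show False using i \<rho>(1)[of 0] exponent_bounds(1)[of i] by (auto simp: L_def T_def)
qed

section \<open>Contractive projections have rank zero, one or full rank\<close>

definition unit_fun :: "nat \<Rightarrow> nat \<Rightarrow> real" where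
  "unit_fun j = (\<lambda>i. if i = j then 1 else 0)"

lemma dot_unit_fun: "j < d \<Longrightarrow> dot d (unit_fun j) x = x j"
  by (simp add: dot_def unit_fun_def if_distrib[where f="\<lambda>z. z * _"] sum.delta cong: if_cong)

lemma app_unit_fun: "j < d \<Longrightarrow> app d P (unit_fun j) i = P i j"
  by (simp add: app_def unit_fun_def if_distrib[where f="\<lambda>z. _ * z"] sum.delta cong: if_cong)

lemma app_idempotent:
  assumes "\<And>i k. i < d \<Longrightarrow> k < d \<Longrightarrow> (\<Sum>l<d. P i l * P l k) = P i k" "i < d"
  shows "app d P (app d P x) i = app d P x i"
proof -
  have "app d P (app d P x) i = (\<Sum>k<d. (\<Sum>l<d. P i l * P l k) * x k)"
    unfolding app_def sum_distrib_left sum_distrib_right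
    by (subst sum.swap) (simp add: mult.assoc)
  also have "\<dots> = app d P x i" unfolding app_def using assms by (intro sum.cong) auto
  finally show ?thesis .
qed

text \<open>The trace of an idempotent is its rank, and it is the trace that is convenient in
  limits. If the rank is at least \<open>2\<close>, the range contains a nonzero vector on each
  hyperplane of \<open>star_vec j\<close>, so separation of singularities shows that
  \<open>star_vec j\<close> is orthogonal to the range or to the kernel. With these terms gone,
  the gradient identity says that range and kernel are orthogonal to each other. So every
  \<open>star_vec j\<close> is either fixed or killed by \<open>P\<close>; as none is orthogonal
  to \<open>star_vec 0\<close>, all share the fate of \<open>star_vec 0\<close>, and
  \<open>P\<close> is the identity or zero.\<close>

theorem trace_of_contractive_projection:
  assumes d: "d > 0"
    and nb: "\<And>x f. energy d x \<le> 1 \<Longrightarrow> f \<in> polar d \<Longrightarrow> dot d f (app d P x) \<le> 1"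
    and idem: "\<And>i k. i < d \<Longrightarrow> k < d \<Longrightarrow> (\<Sum>l<d. P i l * P l k) = P i k"
  shows "(\<Sum>i<d. P i i) \<in> {0, 1, real d}"
proof (cases "(\<Sum>i<d. P i i) = 1")
  case False
  have PP: "app d P (app d P x) i = app d P x i" if "i < d" for x i
    using idem that by (rule app_idempotent)
  define Ker where "Ker w \<longleftrightarrow> (\<forall>i<d. app d P w i = 0)" for w
  have KerI: "Ker (\<lambda>i. x i - app d P x i)" for x
    by (simp add: Ker_def app_linear PP)
  have contact: "dot d (energy_gradient d (\<lambda>i. app d P x i / \<rho>)) w = 0"
    if "Ker w" "energy d (\<lambda>i. app d P x i / \<rho>) = 1" for x w \<rho>
  proof (rule contact_annihilates_kernel[OF nb that(2)])
    have "(\<lambda>i. app d P x i / \<rho>) = app d P (\<lambda>i. inverse \<rho> * x i)"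
      by (simp only: app_scale) (simp add: divide_inverse mult.commute)
    then show "app d P (\<lambda>i. app d P x i / \<rho>) i = app d P x i / \<rho>" if "i < d" for i
      using PP[OF that, of "\<lambda>i. inverse \<rho> * x i"] by metis
  qed (use that(1) in \<open>auto simp: Ker_def\<close>)
  \<comment> \<open>Here \<open>app d P x\<close> ranges over the range of \<open>P\<close>.\<close>
  have alt: "(\<forall>x. star_form d j (app d P x) = 0) \<or> (\<forall>w. Ker w \<longrightarrow> star_form d j w = 0)" if j: "j < d" for j
  proof (rule disjCI)
    assume "\<not> (\<forall>w. Ker w \<longrightarrow> star_form d j w = 0)"
    then obtain w where w: "Ker w" "star_form d j w \<noteq> 0" by blast
    show "\<forall>x. star_form d j (app d P x) = 0"
    proof (rule ccontr)
      assume "\<not> ?thesis"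
      then obtain x1 where x1: "star_form d j (app d P x1) \<noteq> 0" by blast
      define a where "a = star_form d j (app d P x1)"
      have vanish: "dot d (app d P x) (app d P x) = 0" if "star_form d j (app d P x) = 0" for x
      proof (rule ccontr)
        assume nz: "dot d (app d P x) (app d P x) \<noteq> 0"
        have "star_form d j w = 0"
        proof (rule singular_separation[OF _ nz j that x1])
          fix s \<rho> :: real
          have eq: "(\<lambda>i. (app d P x i + s * app d P x1 i) / \<rho>) = (\<lambda>i. app d P (\<lambda>i. x i + s * x1 i) i / \<rho>)"
            by (simp add: app_linear)
          assume "energy d (\<lambda>i. (app d P x i + s * app d P x1 i) / \<rho>) = 1"
          then show "dot d (energy_gradient d (\<lambda>i. (app d P x i + s * app d P x1 i) / \<rho>)) w = 0"
            unfolding eq by (rule contact[OF w(1)])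
        qed
        then show False using w by simp
      qed
      \<comment> \<open>If the range met the hyperplane only in \<open>0\<close>, it would be a line and \<open>P\<close> would have trace \<open>1\<close>.\<close>
      have rank1: "app d P x i = star_form d j (app d P x) / a * app d P x1 i" if "i < d" for x i
      proof -
        define y where "y = (\<lambda>i. x i - (star_form d j (app d P x) / a) * x1 i)"
        have y: "app d P y = (\<lambda>i. app d P x i - (star_form d j (app d P x) / a) * app d P x1 i)"
          unfolding y_def by (simp only: app_linear)
        have "star_form d j (app d P y) = 0" unfolding y using x1 by (simp add: dot_linear a_def)
        then have "app d P y i = 0" using vanish[of y] that by (simp add: dot_self_eq_0)
        then show ?thesis by (simp add: y)
      qed
      have "(\<Sum>i<d. P i i) = (\<Sum>i<d. star_form d j (app d P (unit_fun i)) / a * app d P x1 i)"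
      proof (intro sum.cong refl)
        fix i assume "i \<in> {..<d}"
        then show "P i i = star_form d j (app d P (unit_fun i)) / a * app d P x1 i"
          using rank1[of i "unit_fun i"] by (simp add: app_unit_fun)
      qed
      also have "\<dots> = (\<Sum>i<d. (\<Sum>l<d. star_vec j l * P l i) * app d P x1 i) / a"
        unfolding sum_divide_distrib by (intro sum.cong) (auto simp: dot_def app_unit_fun)
      also have "(\<Sum>i<d. (\<Sum>l<d. star_vec j l * P l i) * app d P x1 i) = star_form d j (app d P (app d P x1))"
        unfolding dot_def app_def[of d P "app d P x1"] sum_distrib_left sum_distrib_right
        by (subst sum.swap) (simp add: mult.assoc)
      also have "\<dots> = a" unfolding a_def by (intro dot_cong PP)
      finally show False using \<open>(\<Sum>i<d. P i i) \<noteq> 1\<close> x1 by (simp add: a_def)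
    qed
  qed
  have orth: "dot d (app d P x) w = 0" if w: "Ker w" for x w
  proof (cases "dot d (app d P x) (app d P x) = 0")
    case True
    then have "\<forall>i<d. app d P x i = 0" by (simp add: dot_self_eq_0)
    then show ?thesis by (simp add: dot_def)
  next
    case False
    from gauge_exists[OF this] obtain \<rho> where \<rho>: "\<rho> > 0" "energy d (\<lambda>i. app d P x i / \<rho>) = 1" by blast
    have "signed_powr (exponent j) (star_form d j (\<lambda>i. app d P x i / \<rho>)) * star_form d j w = 0" if "j < d" for j
      using alt[OF that] w by (auto simp: dot_linear)
    then have "(\<Sum>j<d. (1 + exponent j) * signed_powr (exponent j) (star_form d j (\<lambda>i. app d P x i / \<rho>)) * star_form d j w) = 0"
      by (intro sum.neutral) (auto simp: mult.assoc)
    then show ?thesis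
      using contact[OF w \<rho>(2)] \<rho>(1) unfolding dot_energy_gradient by (simp add: dot_linear)
  qed
  have fix_or_kill: "(\<forall>i<d. app d P (star_vec j) i = star_vec j i) \<or> Ker (star_vec j)" if j: "j < d" for j
    using alt[OF j]
  proof
    define h where "h = (\<lambda>i. star_vec j i - app d P (star_vec j) i)"
    assume "\<forall>w. Ker w \<longrightarrow> star_form d j w = 0"
    then have "star_form d j h = 0" using KerI by (auto simp: h_def)
    moreover have "dot d (app d P (star_vec j)) h = 0" unfolding h_def by (intro orth KerI)
    ultimately have "dot d h h = 0" by (subst h_def) (simp add: dot_linear)
    then show ?thesis by (simp add: dot_self_eq_0 h_def)
  next
    assume "\<forall>x. star_form d j (app d P x) = 0"
    then have "star_form d j (app d P (star_vec j)) = 0" by blast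
    moreover have "dot d (app d P (star_vec j)) (\<lambda>i. star_vec j i - app d P (star_vec j) i) = 0"
      by (intro orth KerI)
    ultimately have "dot d (app d P (star_vec j)) (app d P (star_vec j)) = 0"
      by (simp add: dot_linear dot_commute)
    then show ?thesis by (simp add: dot_self_eq_0 Ker_def)
  qed
  have s0: "star_vec 0 = unit_fun 0" by (auto simp: star_vec_def unit_fun_def)
  have u: "unit_fun j = (\<lambda>i. star_vec j i - star_vec 0 i)" if "j \<noteq> 0" for j
    using that by (auto simp: star_vec_def unit_fun_def)
  have "dot d (star_vec 0) (star_vec j) = star_vec j 0" for j
    unfolding s0 by (rule dot_unit_fun[OF d])
  moreover have "star_vec j 0 = 1" for j by (simp add: star_vec_def)
  ultimately have conn: "dot d (star_vec 0) (star_vec j) = 1" "dot d (star_vec j) (star_vec 0) = 1" for j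
    by (simp_all add: dot_commute[of d "star_vec j"])
  have clash: "False" if "\<forall>i<d. app d P (star_vec a) i = star_vec a i" "Ker (star_vec b)" 
      "dot d (star_vec a) (star_vec b) = 1" for a b
  proof -
    have "dot d (star_vec a) (star_vec b) = dot d (app d P (star_vec a)) (star_vec b)"
      using that(1) by (intro dot_cong_left) simp
    then show False using orth[OF that(2)] that(3) by simp
  qed
  consider "\<forall>i<d. app d P (star_vec 0) i = star_vec 0 i" | "Ker (star_vec 0)"
    using fix_or_kill[OF d] by blast
  then show ?thesis
  proof cases
    case 1
    then have all: "\<forall>i<d. app d P (star_vec j) i = star_vec j i" if "j < d" for j
      using fix_or_kill[OF that] clash[OF 1] conn by blast
    have "P j j = 1" if "j < d" for j
    proof -
      have "app d P (unit_fun j) j = unit_fun j j"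
        using all[OF that] 1 that by (cases "j = 0") (auto simp: s0 u app_diff)
      then show ?thesis using that by (simp add: app_unit_fun) (simp add: unit_fun_def)
    qed
    then show ?thesis by simp
  next
    case 2
    then have all: "Ker (star_vec j)" if "j < d" for j
      using fix_or_kill[OF that] clash[OF _ 2] conn by blast
    have "P j j = 0" if "j < d" for j
    proof -
      have "app d P (unit_fun j) j = 0"
        using all[OF that] 2 that by (cases "j = 0") (auto simp: s0 u app_diff Ker_def)
      then show ?thesis using that by (simp add: app_unit_fun)
    qed
    then show ?thesis by simp
  qed
qed simp

section \<open>A finite certificate by compactness\<close>

lemma unit_fun_in_polar:
  assumes "i < d" shows "unit_fun i \<in> polar d"
proof -
  have "y i \<le> 1" if "energy d y \<le> 1" for y
  proof -
    have "(y i)\<^sup>2 \<le> dot d y y"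
      unfolding dot_def power2_eq_square using assms by (intro member_le_sum) auto
    also have "\<dots> \<le> energy d y" by (simp add: energy_def sum_nonneg)
    finally have "(y i)\<^sup>2 \<le> 1\<^sup>2" using that by simp
    then show ?thesis by (rule power2_le_imp_le) simp
  qed
  then show ?thesis using assms by (simp add: polar_def dot_unit_fun)
qed

lemma scaled_unit_fun_in_body:
  assumes "j < d" shows "energy d (\<lambda>i. 1 / (real d + 1) * unit_fun j i) \<le> 1"
proof -
  define c where "c = 1 / (real d + 1)"
  have c: "0 < c" "c \<le> 1" by (auto simp: c_def)
  have star: "star_form d k (unit_fun j) = star_vec k j" for k using dot_unit_fun[OF assms] by (simp add: dot_commute)
  have "\<bar>star_form d k (\<lambda>i. c * unit_fun j i)\<bar> powr (1 + exponent k) \<le> c" for k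
  proof -
    have "c powr (1 + exponent k) \<le> c powr 1"
      using c exponent_bounds(1)[of k] by (intro powr_mono') auto
    moreover have "star_vec k j \<in> {0, 1}" by (simp add: star_vec_def)
    ultimately show ?thesis using c by (auto simp: dot_scale_right star)
  qed
  then have "(\<Sum>k<d. \<bar>star_form d k (\<lambda>i. c * unit_fun j i)\<bar> powr (1 + exponent k)) \<le> (\<Sum>k<d. c)"
    by (intro sum_mono)
  moreover have "dot d (\<lambda>i. c * unit_fun j i) (\<lambda>i. c * unit_fun j i) \<le> c"
    using c dot_unit_fun[OF assms, of "unit_fun j"] by (simp add: dot_linear unit_fun_def mult_left_le)
  ultimately have "energy d (\<lambda>i. c * unit_fun j i) \<le> c + real d * c" unfolding energy_def by simp
  also have "\<dots> = 1" by (simp add: c_def field_simps)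
  finally show ?thesis by (simp add: c_def)
qed

lemma continuous_on_entry: "continuous_on A (\<lambda>P::nat \<Rightarrow> nat \<Rightarrow> real. P i j)"
  by (rule continuous_on_subset[of UNIV])
     (intro continuous_on_product_then_coordinatewise[of UNIV "\<lambda>P. P i"] continuous_on_product_coordinates, simp)

lemma compact_bounded_arrays:
  fixes r :: "nat \<Rightarrow> nat \<Rightarrow> real"
  shows "compact {P. \<forall>i j. \<bar>P i j\<bar> \<le> r i j}"
proof -
  have "compact (PiE UNIV (\<lambda>i. PiE UNIV (\<lambda>j. {- r i j..r i j})))"
    unfolding compactin_euclidean_iff[symmetric] euclidean_product_topology[symmetric] compactin_PiE
    by (auto simp: compactin_euclidean_iff euclidean_product_topology compactin_PiE)
  moreover have "PiE UNIV (\<lambda>i. PiE UNIV (\<lambda>j. {- r i j..r i j})) = {P. \<forall>i j. \<bar>P i j\<bar> \<le> r i j}"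
    by (auto simp: abs_le_iff minus_le_iff PiE_def Pi_def)
  ultimately show ?thesis by simp
qed

text \<open>Idempotents of intermediate trace form a closed set, and those with bounded entries a
  compact one. Each of them is expelled from the contractions by some pair of a body point and a
  polar functional, which is an open condition, so finitely many pairs and one constant \<open>C
  > 1\<close> serve all bounded idempotents. An idempotent with a large entry is detected by a
  scaled unit vector and a coordinate functional. One further pair with value \<open>1\<close>
  will make the joint spectral radius of the uncompressed matrices equal to \<open>1\<close>.\<close>

theorem finite_certificate:
  assumes d: "d > 0"
  obtains X F C where "finite X" "finite F" "C > 1" "\<And>x. x \<in> X \<Longrightarrow> energy d x \<le> 1" "F \<subseteq> polar d"
    "\<exists>x\<in>X. \<exists>f\<in>F. dot d f x = 1"
    "\<And>P k. \<lbrakk>\<And>i j. i < d \<Longrightarrow> j < d \<Longrightarrow> (\<Sum>l<d. P i l * P l j) = P i j; (\<Sum>i<d. P i i) = real k; k \<in> {2..d - 1}\<rbrakk>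
        \<Longrightarrow> \<exists>x\<in>X. \<exists>f\<in>F. C \<le> \<bar>dot d f (app d P x)\<bar>"
proof -
  \<comment> \<open>The scaled unit vectors have length \<open>1 / (d + 1)\<close>, so an entry above \<open>R\<close> yields a value above \<open>2 \<ge> C\<close>.\<close>
  define R where "R = 2 * (real d + 1)"
  \<comment> \<open>Entries outside the \<open>d \<times> d\<close> block are set to \<open>0\<close>, because the product topology sees them all.\<close>
  define K where "K = {P. \<forall>i j. \<bar>P i j\<bar> \<le> (if i < d \<and> j < d then R else 0)} \<inter> 
     ({P. \<forall>i\<in>{..<d}. \<forall>j\<in>{..<d}. (\<Sum>l<d. P i l * P l j) = P i j} \<inter>
     {P. (\<Sum>i<d. P i i) \<in> real ` {2..d - 1}})"
  have "closed {P. \<forall>i\<in>{..<d}. \<forall>j\<in>{..<d}. (\<Sum>l<d. P i l * P l j) = (P i j::real)}"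
    unfolding Collect_ball_eq
    by (intro closed_INT ballI closed_Collect_eq continuous_intros continuous_on_entry)
  moreover have "closed ((\<lambda>P. \<Sum>i<d. P i i::real) -` (real ` {2..d - 1}))"
    by (intro closed_vimage continuous_intros continuous_on_entry finite_imp_closed) auto
  then have "closed {P. (\<Sum>i<d. P i i::real) \<in> real ` {2..d - 1}}" by (simp add: vimage_def)
  ultimately have cK: "compact K" unfolding K_def
    by (intro compact_Int_closed compact_bounded_arrays closed_Int)
  define E where "E = {x. energy d x \<le> 1} \<times> polar d \<times> (UNIV :: nat set)"
  define U where "U = (\<lambda>(x, f, n::nat). {P. 1 + 1 / (real n + 1) < dot d f (app d P x)})"
  have openU: "open (U e)" if "e \<in> E" for e
    unfolding U_def dot_def app_def 
    by (cases e) (auto intro!: open_Collect_less continuous_intros continuous_on_entry)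
  have cover: "K \<subseteq> (\<Union>e\<in>E. U e)"
  proof
    fix P assume P: "P \<in> K"
    then obtain k where k: "k \<in> {2..d - 1}" "(\<Sum>i<d. P i i) = real k" by (auto simp: K_def)
    have "\<exists>x f. energy d x \<le> 1 \<and> f \<in> polar d \<and> 1 < dot d f (app d P x)"
    proof (rule ccontr)
      assume "\<not> ?thesis"
      then have "(\<Sum>i<d. P i i) \<in> {0, 1, real d}"
        using P by (intro trace_of_contractive_projection d) (auto simp: K_def not_less)
      then show False using k by auto
    qed
    then obtain x f where xf: "energy d x \<le> 1" "f \<in> polar d" "0 < dot d f (app d P x) - 1" by auto
    then obtain n where "inverse (real (Suc n)) < dot d f (app d P x) - 1"
      using reals_Archimedean by blast
    then have "P \<in> U (x, f, n)" by (simp add: U_def inverse_eq_divide add.commute)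
    then show "P \<in> (\<Union>e\<in>E. U e)" using xf by (auto simp: E_def)
  qed
  obtain E' where E': "E' \<subseteq> E" "finite E'" "K \<subseteq> (\<Union>e\<in>E'. U e)"
    using compactE_image[OF cK openU cover] by metis
  \<comment> \<open>The element \<open>0\<close> only makes the maximum exist for an empty cover.\<close>
  define N where "N = Max (insert 0 ((snd \<circ> snd) ` E'))"
  obtain \<rho> where \<rho>: "energy d (\<lambda>i. unit_fun 0 i / \<rho>) = 1"
    using gauge_exists[of d "unit_fun 0"] d by (auto simp: dot_unit_fun) (auto simp: unit_fun_def)
  define z where "z = (\<lambda>i. unit_fun 0 i / \<rho>)"
  define g where "g = (\<lambda>i. energy_gradient d z i / dot d (energy_gradient d z) z)"
  define X where "X = insert z (fst ` E' \<union> (\<lambda>j i. 1 / (real d + 1) * unit_fun j i) ` {..<d})"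
  define F where "F = insert g ((fst \<circ> snd) ` E' \<union> unit_fun ` {..<d})"
  define C where "C = 1 + 1 / (real N + 1)"
  have z: "energy d z = 1" using \<rho> by (simp add: z_def)
  have "finite X" "finite F" using E' by (auto simp: X_def F_def)
  moreover have "C > 1" by (simp add: C_def)
  moreover have "\<And>x. x \<in> X \<Longrightarrow> energy d x \<le> 1"
    using E' z scaled_unit_fun_in_body[of _ d] by (auto simp: X_def E_def)
  moreover have "F \<subseteq> polar d"
    using E' contact_functional(2)[OF z] unit_fun_in_polar by (auto simp: F_def E_def g_def)
  moreover have "dot d g z = 1" using contact_functional(1)[OF z] by (simp add: g_def dot_divide_left)
  then have "\<exists>x\<in>X. \<exists>f\<in>F. dot d f x = 1" by (auto simp: X_def F_def)
  moreover have "\<exists>x\<in>X. \<exists>f\<in>F. C \<le> \<bar>dot d f (app d P x)\<bar>"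
    if P: "\<And>i j. i < d \<Longrightarrow> j < d \<Longrightarrow> (\<Sum>l<d. P i l * P l j) = P i j" "(\<Sum>i<d. P i i) = real k" "k \<in> {2..d - 1}" for P k
  proof (cases "\<forall>i<d. \<forall>j<d. \<bar>P i j\<bar> \<le> R")
    case True
    define Q where "Q = (\<lambda>i j. if i < d \<and> j < d then P i j else 0)"
    have "Q \<in> K" unfolding K_def Q_def using True P by auto
    then obtain x f n where xf: "(x, f, n) \<in> E'" "Q \<in> U (x, f, n)" using E' by auto
    have "app d Q x i = app d P x i" if "i < d" for i using that by (simp add: app_def Q_def)
    then have "dot d f (app d Q x) = dot d f (app d P x)" by (rule dot_cong)
    then have "1 + 1 / (real n + 1) < dot d f (app d P x)" using xf by (simp add: U_def)
    moreover have "n \<le> N" unfolding N_def using xf E' by (intro Max_ge) force+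
    then have "C \<le> 1 + 1 / (real n + 1)" by (simp add: C_def frac_le)
    ultimately show ?thesis using xf by (force simp: X_def F_def)
  next
    case False
    then obtain i j where ij: "i < d" "j < d" "R < \<bar>P i j\<bar>" by force
    have "dot d (unit_fun i) (app d P (\<lambda>l. 1 / (real d + 1) * unit_fun j l)) = 1 / (real d + 1) * P i j"
      using ij by (simp only: app_scale dot_linear dot_unit_fun app_unit_fun)
    moreover have "2 \<le> 1 / (real d + 1) * \<bar>P i j\<bar>" using ij by (simp add: R_def field_simps)
    moreover have "C \<le> 2" by (simp add: C_def field_simps)
    ultimately have "C \<le> \<bar>dot d (unit_fun i) (app d P (\<lambda>l. 1 / (real d + 1) * unit_fun j l))\<bar>"
      by (simp add: abs_mult)
    then show ?thesis using ij by (auto simp: X_def F_def intro!: bexI)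
  qed
  ultimately show ?thesis by (rule that)
qed

section \<open>Joint spectral radius of rank-one matrices\<close>

lemma dot_Cauchy_Schwarz: "\<bar>dot d x y\<bar> \<le> sqrt (dot d x x) * sqrt (dot d y y)"
proof -
  have "(dot d x y)\<^sup>2 \<le> dot d x x * dot d y y"
    unfolding dot_def using Cauchy_Schwarz_ineq_sum[of x y "{..<d}"] by (simp add: power2_eq_square)
  then have "sqrt ((dot d x y)\<^sup>2) \<le> sqrt (dot d x x * dot d y y)" by (rule real_sqrt_le_mono)
  then show ?thesis by (simp add: real_sqrt_mult)
qed

definition outer :: "nat \<Rightarrow> (nat \<Rightarrow> real) \<Rightarrow> (nat \<Rightarrow> real) \<Rightarrow> real mat" where
  "outer n u v = mat n n (\<lambda>(i, j). u i * v j)"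

lemma outer_carrier [simp]: "outer n u v \<in> carrier_mat n n"
  by (simp add: outer_def)

lemma vec_norm2_eq: "vec_norm2 x = sqrt (dot (dim_vec x) (vec_index x) (vec_index x))"
  by (simp add: vec_norm2_def dot_def scalar_prod_def lessThan_atLeast0)

lemma outer_mult:
  "outer n u v * outer n u' v' = outer n (\<lambda>i. dot n v u' * u i) v'"
  by (rule eq_matI)
     (auto simp: outer_def scalar_prod_def dot_def lessThan_atLeast0 sum_distrib_left sum_distrib_right
        intro!: sum.cong)

lemma vec_norm2_outer_apply:
  assumes "x \<in> carrier_vec n"
  shows "vec_norm2 (outer n u v *\<^sub>v x) = sqrt (dot n u u) * \<bar>dot n v (vec_index x)\<bar>"
proof -
  have "(outer n u v *\<^sub>v x) $ i = dot n v (vec_index x) * u i" if "i < n" for i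
    using assms that
    by (simp add: outer_def scalar_prod_def dot_def lessThan_atLeast0 sum_distrib_right sum_distrib_left ac_simps)
  then have "dot n (vec_index (outer n u v *\<^sub>v x)) (vec_index (outer n u v *\<^sub>v x))
     = dot n (\<lambda>i. dot n v (vec_index x) * u i) (\<lambda>i. dot n v (vec_index x) * u i)"
    unfolding dot_def by (intro sum.cong) auto
  then show ?thesis
    by (simp add: vec_norm2_eq dot_linear outer_def real_sqrt_mult mult.assoc[symmetric])
qed

lemma spectral_norm_outer:
  "spectral_norm (outer n u v) = sqrt (dot n u u) * sqrt (dot n v v)"
  unfolding spectral_norm_def
proof (rule cSup_eq_maximum)
  define a where "a = sqrt (dot n v v)"
  \<comment> \<open>For \<open>v = 0\<close> this is the zero vector, by division by zero, and the maximum is \<open>0\<close>.\<close>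
  define x where "x = vec n (\<lambda>i. v i / a)"
  have dvx: "dot n v (vec_index x) = dot n v v / a"
    by (subst dot_cong[of n "vec_index x" "\<lambda>i. v i / a"]) (auto simp: x_def dot_linear)
  have dxx: "dot n (vec_index x) (vec_index x) = dot n v v / a / a"
    unfolding dot_cong[of n "vec_index x" "\<lambda>i. v i / a" "vec_index x", unfolded x_def, simplified, folded x_def]
    using dvx by (simp add: dot_linear dot_commute)
  have aa: "dot n v v = a * a" by (simp add: a_def dot_self_nonneg)
  have "vec_norm2 x \<le> 1"
    unfolding vec_norm2_eq using dxx by (simp add: x_def aa)
  moreover have "\<bar>dot n v (vec_index x)\<bar> = a"
    using dvx by (simp add: aa) (simp add: a_def dot_self_nonneg)
  ultimately show "sqrt (dot n u u) * sqrt (dot n v v)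
      \<in> {vec_norm2 (outer n u v *\<^sub>v x) |x. x \<in> carrier_vec (dim_col (outer n u v)) \<and> vec_norm2 x \<le> 1}"
    by (intro CollectI exI[of _ x]) (auto simp: vec_norm2_outer_apply x_def outer_def[of n u v, THEN arg_cong, of dim_col] a_def[symmetric])
next
  fix y assume "y \<in> {vec_norm2 (outer n u v *\<^sub>v x) |x. x \<in> carrier_vec (dim_col (outer n u v)) \<and> vec_norm2 x \<le> 1}"
  then obtain x where x: "x \<in> carrier_vec n" "vec_norm2 x \<le> 1" "y = vec_norm2 (outer n u v *\<^sub>v x)"
    by (auto simp: outer_def)
  have "\<bar>dot n v (vec_index x)\<bar> \<le> sqrt (dot n v v) * vec_norm2 x"
    using dot_Cauchy_Schwarz[of n v "vec_index x"] x(1) by (simp add: vec_norm2_eq)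
  also have "\<dots> \<le> sqrt (dot n v v)" using x(2) dot_self_nonneg[of n v] by (simp add: mult_left_le)
  finally show "y \<le> sqrt (dot n u u) * sqrt (dot n v v)"
    using x dot_self_nonneg[of n u] by (simp add: vec_norm2_outer_apply mult_left_mono)
qed

lemma left_prod_outer:
  assumes "\<And>s. s < Suc t \<Longrightarrow> A s \<in> (\<lambda>(u, v). outer n u v) ` (U \<times> V)"
    and bound: "\<And>u v. u \<in> U \<Longrightarrow> v \<in> V \<Longrightarrow> \<bar>dot n v u\<bar> \<le> m"
  shows "\<exists>c. \<exists>u\<in>U. \<exists>v\<in>V. \<bar>c\<bar> \<le> m ^ t \<and> left_prod n A (Suc t) = outer n (\<lambda>i. c * u i) v"
  using assms(1)
proof (induction t)
  case 0
  then obtain u v where "u \<in> U" "v \<in> V" "A 0 = outer n u v" by fastforce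
  then have "left_prod n A (Suc 0) = outer n (\<lambda>i. 1 * u i) v"
    by (simp add: right_mult_one_mat[OF outer_carrier])
  moreover have "\<bar>1 :: real\<bar> \<le> m ^ 0" by simp
  ultimately show ?case using \<open>u \<in> U\<close> \<open>v \<in> V\<close> by blast
next
  case (Suc t)
  then obtain c u v where IH: "u \<in> U" "v \<in> V" "\<bar>c\<bar> \<le> m ^ t" "left_prod n A (Suc t) = outer n (\<lambda>i. c * u i) v"
    by (meson less_Suc_eq)
  obtain u' v' where A: "u' \<in> U" "v' \<in> V" "A (Suc t) = outer n u' v'"
    using Suc.prems[of "Suc t"] by fastforce
  have "left_prod n A (Suc (Suc t)) = outer n (\<lambda>i. (c * dot n v' u) * u' i) v"
    using IH(4) A(3) by (simp add: outer_mult dot_linear)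
  moreover have "\<bar>c * dot n v' u\<bar> \<le> m ^ Suc t"
    using mult_mono'[OF bound[OF IH(1) A(2)] IH(3)] by (simp add: abs_mult mult.commute)
  ultimately show ?case using A(1) IH(2) by blast
qed

lemma left_prod_outer_const:
  "left_prod n (\<lambda>_. outer n u v) (Suc t) = outer n (\<lambda>i. dot n v u ^ t * u i) v"
proof (induction t)
  case 0
  show ?case by (simp add: right_mult_one_mat[OF outer_carrier])
next
  case (Suc t)
  have "left_prod n (\<lambda>_. outer n u v) (Suc (Suc t)) = outer n u v * outer n (\<lambda>i. dot n v u ^ t * u i) v"
    by (subst left_prod.simps(2)) (simp only: Suc.IH)
  then show ?case by (simp only: outer_mult dot_linear) (simp add: ac_simps)
qed

text \<open>A product of rank-one matrices \<open>u v\<^sup>T\<close> is again of rank one,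
  scaled by the inner products of neighbouring factors. The norms of products of length \<open>t
  + 1\<close> therefore grow at most like \<open>m ^ t\<close>, and powers of the matrix \<open>a
  b\<^sup>T\<close> reach this growth. This also shows that the defining limit exists.\<close>

theorem jsr_outer:
  assumes fin: "finite U" "finite V"
    and bound: "\<And>u v. u \<in> U \<Longrightarrow> v \<in> V \<Longrightarrow> \<bar>dot n v u\<bar> \<le> m"
    and attained: "a \<in> U" "b \<in> V" "\<bar>dot n b a\<bar> = m" and m: "m > 0"
  shows "jsr n ((\<lambda>(u, v). outer n u v) ` (U \<times> V)) = m"
proof -
  define M where "M = (\<lambda>(u, v). outer n u v) ` (U \<times> V)"
  define L where "L = Max ((\<lambda>(u, v). sqrt (dot n u u) * sqrt (dot n v v)) ` (U \<times> V))"
  define S where "S t = Sup (spectral_norm ` products n M t)" for t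
  have L: "sqrt (dot n u u) * sqrt (dot n v v) \<le> L" if "u \<in> U" "v \<in> V" for u v
    unfolding L_def using fin that by (intro Max_ge) auto
  have scaled: "spectral_norm (outer n (\<lambda>i. c * u i) v) = \<bar>c\<bar> * (sqrt (dot n u u) * sqrt (dot n v v))" for c u v
    by (simp add: spectral_norm_outer dot_linear real_sqrt_mult mult.assoc[symmetric])
  have upper: "y \<le> m ^ t * L" if y: "y \<in> spectral_norm ` products n M (Suc t)" for y t
  proof -
    obtain Q where Q: "Q \<in> products n M (Suc t)" "y = spectral_norm Q" using y by blast
    then obtain A where A: "\<And>s. s < Suc t \<Longrightarrow> A s \<in> M" "y = spectral_norm (left_prod n A (Suc t))"
      unfolding products_def mem_Collect_eq by metis
    obtain c u v where cuv: "u \<in> U" "v \<in> V" "\<bar>c\<bar> \<le> m ^ t" "left_prod n A (Suc t) = outer n (\<lambda>i. c * u i) v"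
      using left_prod_outer[of t A n U V m] A(1) bound unfolding M_def by blast
    then have "y = \<bar>c\<bar> * (sqrt (dot n u u) * sqrt (dot n v v))" using A(2) scaled by metis
    also have "\<dots> \<le> m ^ t * L"
      using cuv L[OF cuv(1,2)] m by (intro mult_mono) (auto simp: dot_self_nonneg)
    finally show ?thesis .
  qed
  have nonempty: "spectral_norm (left_prod n (\<lambda>_. outer n a b) (Suc t)) \<in> spectral_norm ` products n M (Suc t)" for t
    unfolding products_def M_def using attained by blast
  have S_le: "S (Suc t) \<le> m ^ t * L" for t
    unfolding S_def using upper nonempty by (intro cSup_least) blast+
  have S_ge: "m ^ Suc t \<le> S (Suc t)" for t
  proof -
    have "m \<le> sqrt (dot n a a) * sqrt (dot n b b)"
      using dot_Cauchy_Schwarz[of n b a] attained(3) by (simp add: mult.commute)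
    then have "m ^ t * m \<le> m ^ t * (sqrt (dot n a a) * sqrt (dot n b b))"
      using m by (intro mult_left_mono) auto
    also have "\<dots> = spectral_norm (left_prod n (\<lambda>_. outer n a b) (Suc t))"
      unfolding left_prod_outer_const scaled using attained(3) by (simp add: power_abs)
    also have "\<dots> \<le> S (Suc t)"
      unfolding S_def using nonempty upper by (intro cSup_upper bdd_aboveI) 
    finally show ?thesis by (simp add: mult.commute)
  qed
  have "m \<le> L"
    using S_ge[of 0] S_le[of 0] by simp
  have "(\<lambda>t. root (Suc t) (S (Suc t))) \<longlonglongrightarrow> m"
  proof (rule tendsto_sandwich)
    show "\<forall>\<^sub>F t in sequentially. m \<le> root (Suc t) (S (Suc t))"
    proof (intro always_eventually allI)
      fix t have "root (Suc t) (m ^ Suc t) \<le> root (Suc t) (S (Suc t))"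
        using S_ge by (subst real_root_le_iff) auto
      then show "m \<le> root (Suc t) (S (Suc t))" using m by (simp only: real_root_power_cancel less_imp_le zero_less_Suc)
    qed
    show "\<forall>\<^sub>F t in sequentially. root (Suc t) (S (Suc t)) \<le> m * root (Suc t) (L / m)"
    proof (intro always_eventually allI)
      fix t have "root (Suc t) (S (Suc t)) \<le> root (Suc t) (m ^ Suc t * (L / m))"
        using S_le[of t] m by (subst real_root_le_iff) auto
      then show "root (Suc t) (S (Suc t)) \<le> m * root (Suc t) (L / m)"
        using m by (simp only: real_root_mult real_root_power_cancel less_imp_le zero_less_Suc)
    qed
    have "(\<lambda>t. root t (L / m)) \<longlonglongrightarrow> 1" using m \<open>m \<le> L\<close> by (intro LIMSEQ_root_const) auto
    then have "(\<lambda>t. m * root (Suc t) (L / m)) \<longlonglongrightarrow> m * 1"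
      by (intro tendsto_mult tendsto_const LIMSEQ_Suc)
    then show "(\<lambda>t. m * root (Suc t) (L / m)) \<longlonglongrightarrow> m" by simp
  qed simp
  then have "(\<lambda>t. root t (S t)) \<longlonglongrightarrow> m" by (rule LIMSEQ_imp_Suc)
  then show ?thesis unfolding jsr_def S_def M_def by (rule limI)
qed

section \<open>Compressions of rank-one matrices\<close>

lemma bij_betw_pick:
  assumes "finite J" shows "bij_betw (pick J) {..<card J} J"
proof -
  have inj: "inj_on (pick J) {..<card J}"
  proof (rule linorder_inj_onI')
    fix i j assume "j \<in> {..<card J}" "i < j"
    then have "pick J i < pick J j" by (intro pick_mono_le) auto
    then show "pick J i \<noteq> pick J j" by simp
  qed
  moreover have "pick J ` {..<card J} \<subseteq> J" using pick_in_set_le by auto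
  then have "pick J ` {..<card J} = J"
    using assms inj by (intro card_subset_eq) (auto simp: card_image)
  ultimately show ?thesis by (simp add: bij_betw_def)
qed

lemma submatrix_outer:
  assumes "J \<subseteq> {0..<d}"
  shows "submatrix (outer d u v) J J = outer (card J) (u \<circ> pick J) (v \<circ> pick J)"
proof -
  have J: "{i. i < d \<and> i \<in> J} = J" using assms by auto
  have "pick J i < d" if "i < card J" for i using pick_in_set_le[OF that] assms by auto
  then show ?thesis unfolding submatrix_def outer_def by (intro eq_matI) (auto simp: J)
qed

lemma mult_mat_entry:
  assumes "A \<in> carrier_mat d d" "B \<in> carrier_mat d d" "i < d" "j < d"
  shows "(A * B) $$ (i, j) = (\<Sum>k<d. A $$ (i, k) * B $$ (k, j))"
  using assms by (simp add: scalar_prod_def lessThan_atLeast0)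

lemma outer_conjugate:
  assumes "A \<in> carrier_mat d d" "B \<in> carrier_mat d d"
  shows "A * outer d u v * B = outer d (\<lambda>i. \<Sum>l<d. A $$ (i, l) * u l) (\<lambda>j. \<Sum>l<d. v l * B $$ (l, j))"
    (is "_ = outer d ?u ?v")
proof (rule eq_matI)
  fix i j assume "i < dim_row (outer d ?u ?v)" "j < dim_col (outer d ?u ?v)"
  then have ij: "i < d" "j < d" by (auto simp: outer_def)
  have AO: "A * outer d u v \<in> carrier_mat d d" using assms(1) by simp
  have "(A * outer d u v) $$ (i, k) = ?u i * v k" if "k < d" for k
    using mult_mat_entry[OF assms(1) outer_carrier ij(1) that] that
    by (simp add: outer_def sum_distrib_right mult.assoc)
  then have "(A * outer d u v * B) $$ (i, j) = (\<Sum>k<d. ?u i * v k * B $$ (k, j))"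
    using mult_mat_entry[OF AO assms(2) ij] by simp
  also have "\<dots> = ?u i * ?v j" by (simp only: sum_distrib_left mult.assoc)
  finally show "(A * outer d u v * B) $$ (i, j) = outer d ?u ?v $$ (i, j)"
    using ij by (simp add: outer_def)
qed (use assms in \<open>auto simp: outer_def\<close>)

lemma GL_inverse:
  assumes "T \<in> GL d"
  defines "S \<equiv> inv\<^bsub>ring_mat TYPE(real) d ()\<^esub> T"
  shows "T \<in> carrier_mat d d" "S \<in> carrier_mat d d" "S * T = 1\<^sub>m d" "T * S = 1\<^sub>m d"
proof -
  interpret ring "ring_mat TYPE(real) d ()" by (rule ring_mat)
  have T: "T \<in> Units (ring_mat TYPE(real) d ())" using assms(1) by (simp add: GL_def)
  show "T \<in> carrier_mat d d" "S \<in> carrier_mat d d" "S * T = 1\<^sub>m d" "T * S = 1\<^sub>m d"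
    using Units_closed[OF T] Units_inv_closed[OF T] Units_l_inv[OF T] Units_r_inv[OF T]
    by (simp_all add: S_def ring_mat_simps)
qed

text \<open>Compressing \<open>x f\<^sup>T\<close> to \<open>J\<close> in the basis
  \<open>T\<close> gives the rank-one matrix of the truncated vectors \<open>T\<^sup>-\<^sup>1
  x\<close> and \<open>f\<^sup>T T\<close>. Their inner product is \<open>f\<^sup>T P x\<close>,
  where \<open>P\<close> is the projection onto the span of the columns of \<open>T\<close> in
  \<open>J\<close> along the remaining ones. So the joint spectral radius of the compression is
  the maximum of the numbers \<open>|f\<^sup>T P x|\<close>, to which the certificate applies
  with trace \<open>card J\<close>.\<close>

theorem theorem4p1:
  fixes d :: nat
  assumes "d \<ge> 3"
  shows "\<exists>(M :: real mat set) (C :: real).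
           finite M \<and> M \<noteq> {} \<and> M \<subseteq> carrier_mat d d \<and> jsr d M = 1 \<and> C > 1 \<and>
           (\<forall>T \<in> GL d. \<forall>J. J \<subseteq> {0..<d} \<and> card J \<in> {2..d - 1} \<longrightarrow>
              jsr (card J) (principal_submatrices J (conj_set d T M)) \<ge> C)"
proof (rule finite_certificate)
  show "d > 0" using assms by simp
next
  fix X F C
  assume fin: "finite X" "finite F" and C: "C > (1 :: real)"
    and X: "\<And>x. x \<in> X \<Longrightarrow> energy d x \<le> 1" and F: "F \<subseteq> polar d"
    and contact: "\<exists>x\<in>X. \<exists>f\<in>F. dot d f x = 1"
    and cert: "\<And>P k. \<lbrakk>\<And>i j. i < d \<Longrightarrow> j < d \<Longrightarrow> (\<Sum>l<d. P i l * P l j) = P i j;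
        (\<Sum>i<d. P i i) = real k; k \<in> {2..d - 1}\<rbrakk> \<Longrightarrow> \<exists>x\<in>X. \<exists>f\<in>F. C \<le> \<bar>dot d f (app d P x)\<bar>"
  obtain x0 f0 where xf0: "x0 \<in> X" "f0 \<in> F" "dot d f0 x0 = 1" using contact by blast
  define M where "M = (\<lambda>(x, f). outer d x f) ` (X \<times> F)"
  have "jsr d M = 1" unfolding M_def
    by (rule jsr_outer[OF fin _ xf0(1,2)]) (use polar_bound X F xf0 in auto)
  moreover have "C \<le> jsr (card J) (principal_submatrices J (conj_set d T M))"
    if T: "T \<in> GL d" and J: "J \<subseteq> {0..<d}" "card J \<in> {2..d - 1}" for T J
  proof -
    define S where "S = inv\<^bsub>ring_mat TYPE(real) d ()\<^esub> T"
    note TS = GL_inverse[OF T, folded S_def]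
    have finJ: "finite J" using J(1) finite_subset by blast
    have ST: "(\<Sum>l<d. S $$ (i, l) * T $$ (l, j)) = (if i = j then 1 else 0)" if "i < d" "j < d" for i j
    proof -
      have "(S * T) $$ (i, j) = (\<Sum>l<d. S $$ (i, l) * T $$ (l, j))"
        using TS(1,2) that by (simp add: scalar_prod_def lessThan_atLeast0)
      then show ?thesis using TS(3) that by simp
    qed
    define P where "P i l = (\<Sum>j\<in>J. T $$ (i, j) * S $$ (j, l))" for i l
    define \<alpha> where "\<alpha> x = (\<lambda>i. \<Sum>l<d. S $$ (i, l) * x l) \<circ> pick J" for x
    define \<beta> where "\<beta> f = (\<lambda>j. \<Sum>l<d. f l * T $$ (l, j)) \<circ> pick J" for f
    have eq: "principal_submatrices J (conj_set d T M) = (\<lambda>(u, v). outer (card J) u v) ` ((\<alpha> ` X) \<times> (\<beta> ` F))"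
    proof -
      have "submatrix (S * outer d x f * T) J J = outer (card J) (\<alpha> x) (\<beta> f)" for x f
        unfolding outer_conjugate[OF TS(2,1)] submatrix_outer[OF J(1)] \<alpha>_def \<beta>_def ..
      then show ?thesis
        unfolding principal_submatrices_def conj_set_def M_def S_def[symmetric]
        by (force simp: image_iff)
    qed
    have dot: "dot (card J) (\<beta> f) (\<alpha> x) = dot d f (app d P x)" for f x
    proof -
      have "dot (card J) (\<beta> f) (\<alpha> x) = (\<Sum>j\<in>J. (\<Sum>l<d. f l * T $$ (l, j)) * (\<Sum>l<d. S $$ (j, l) * x l))"
        unfolding dot_def \<alpha>_def \<beta>_def comp_def
        by (rule sum.reindex_bij_betw[OF bij_betw_pick[OF finJ]])
      also have "\<dots> = (\<Sum>j\<in>J. \<Sum>l<d. \<Sum>k<d. f l * (T $$ (l, j) * S $$ (j, k) * x k))"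
        by (simp add: sum_product mult.assoc)
      also have "\<dots> = (\<Sum>l<d. \<Sum>j\<in>J. \<Sum>k<d. f l * (T $$ (l, j) * S $$ (j, k) * x k))"
        by (rule sum.swap)
      also have "\<dots> = (\<Sum>l<d. \<Sum>k<d. \<Sum>j\<in>J. f l * (T $$ (l, j) * S $$ (j, k) * x k))"
        by (intro sum.cong refl sum.swap)
      also have "\<dots> = dot d f (app d P x)"
        by (simp add: dot_def app_def P_def sum_distrib_left sum_distrib_right)
      finally show ?thesis .
    qed
    have "(\<Sum>l<d. P i l * P l k) = P i k" for i k
    proof -
      have "(\<Sum>l<d. P i l * P l k) = (\<Sum>l<d. \<Sum>j\<in>J. \<Sum>j'\<in>J. T $$ (i, j) * (S $$ (j, l) * T $$ (l, j')) * S $$ (j', k))"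
        by (simp add: P_def sum_product mult.assoc)
      also have "\<dots> = (\<Sum>j\<in>J. \<Sum>l<d. \<Sum>j'\<in>J. T $$ (i, j) * (S $$ (j, l) * T $$ (l, j')) * S $$ (j', k))"
        by (rule sum.swap)
      also have "\<dots> = (\<Sum>j\<in>J. \<Sum>j'\<in>J. \<Sum>l<d. T $$ (i, j) * (S $$ (j, l) * T $$ (l, j')) * S $$ (j', k))"
        by (intro sum.cong refl sum.swap)
      also have "\<dots> = (\<Sum>j\<in>J. \<Sum>j'\<in>J. T $$ (i, j) * (if j = j' then 1 else 0) * S $$ (j', k))"
      proof (intro sum.cong refl)
        fix j j' assume "j \<in> J" "j' \<in> J"
        then have "j < d" "j' < d" using J(1) by auto
        from ST[OF this] show "(\<Sum>l<d. T $$ (i, j) * (S $$ (j, l) * T $$ (l, j')) * S $$ (j', k))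
            = T $$ (i, j) * (if j = j' then 1 else 0) * S $$ (j', k)"
          by (simp only: sum_distrib_left[symmetric] sum_distrib_right[symmetric])
      qed
      also have "\<dots> = P i k"
        unfolding P_def using finJ
        by (intro sum.cong refl) (simp add: if_distrib[where f = "\<lambda>z. _ * z * _"] sum.delta cong: if_cong)
      finally show ?thesis .
    qed
    moreover have "(\<Sum>i<d. P i i) = real (card J)"
    proof -
      have "(\<Sum>i<d. P i i) = (\<Sum>j\<in>J. \<Sum>i<d. S $$ (j, i) * T $$ (i, j))"
        unfolding P_def by (subst sum.swap) (simp add: mult.commute)
      also have "\<dots> = (\<Sum>j\<in>J. 1)" using ST J(1) by (intro sum.cong) auto
      finally show ?thesis by simp
    qed
    ultimately obtain x f where xf: "x \<in> X" "f \<in> F" "C \<le> \<bar>dot d f (app d P x)\<bar>"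
      using cert[OF _ _ J(2), of P] by blast
    define D where "D = (\<lambda>(u, v). \<bar>dot (card J) v u\<bar>) ` ((\<alpha> ` X) \<times> (\<beta> ` F))"
    have D: "finite D" "D \<noteq> {}" using fin xf by (auto simp: D_def)
    have "C \<le> Max D" using xf D dot[of f x] by (intro order_trans[OF xf(3) Max_ge]) (force simp: D_def)+
    define m where "m = Max D"
    have "m \<in> D" unfolding m_def using D by (rule Max_in)
    then obtain a b where ab: "a \<in> \<alpha> ` X" "b \<in> \<beta> ` F" "\<bar>dot (card J) b a\<bar> = Max D"
      unfolding m_def[symmetric] by (auto simp: D_def)
    have "jsr (card J) (principal_submatrices J (conj_set d T M)) = Max D" unfolding eq
      by (rule jsr_outer[OF _ _ _ ab]) (use fin D \<open>C \<le> Max D\<close> C in \<open>auto simp: D_def intro!: Max_ge\<close>)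
    then show ?thesis using \<open>C \<le> Max D\<close> by simp
  qed
  moreover have "finite M" "M \<noteq> {}" "M \<subseteq> carrier_mat d d" using fin xf0 by (auto simp: M_def)
  ultimately show ?thesis using C by blast
qed

end
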